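(* Let $\alpha,\beta,k,c>0$, $T_{\mathrm m}\in\mathbb R$, and let $\varepsilon_1>-1$, $\varepsilon_2>-1$. Consider the closed-loop system $$T_t(x,t)=\alpha(1+\varepsilon_1)T_{xx}(x,t)\ (0\le x\le s(t)),\quad -kT_x(0,t)=q_{\mathrm c}(t),\quad T(s(t),t)=T_{\mathrm m},\quad \dot s(t)=-\beta(1+\varepsilon_2)T_x(s(t),t),$$ with $T(x,0)=T_0(x)$, $s(0)=s_0$, and the control law (built with the nominal parameters $\alpha,\beta$) $$q_{\mathrm c}(t)=-ck\left(\frac1\alpha\int_0^{s(t)}(T(x,t)-T_{\mathrm m})\,dx+\frac1\beta(s(t)-s_{\mathrm r})\right).$$ Assume $s_0>0$, that for some constant $H$ one has $0\le T_0(x)-T_{\mathrm m}\le H(s_0-x)$ for all $x\in[0,s_0]$, and that the setpoint satisfies $$s_{\mathrm r}>s_0+\frac{\beta}{\alpha}\int_0^{s_0}(T_0(x)-T_{\mathrm m})\,dx.$$ Define $$G(c)=\left(\frac{3}{10}\right)^{1/4}\frac{\alpha}{8s_{\mathrm r}^2c},\qquad S_\varepsilon=\left\{(\varepsilon_1,\varepsilon_2)\ :\ (1-G(c))\varepsilon_1-G(c)\le\varepsilon_2\le\varepsilon_1\right\}.$$ Then, for any pair of perturbations $(\varepsilon_1,\varepsilon_2)\in S_\varepsilon$, the closed-loop system is exponentially stable in the sense of the norm $$\|T-T_{\mathrm m}\|_{\mathcal H_1}^2+(s(t)-s_{\mathrm r})^2 .$$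
   Context: The unknowns are the liquid temperature $T(x,t)$, $0\le x\le s(t)$, and the moving interface $s(t)>0$; $(T,s)$ denotes the (classical) solution of the closed-loop system for $t\ge0$. Norms at time $t$: $\|u\|_{\mathcal L_2}^2=\int_0^{s(t)}u(x,t)^2dx$ and $\|u\|_{\mathcal H_1}^2=\|u\|_{\mathcal L_2}^2+\|u_x\|_{\mathcal L_2}^2$. "Exponentially stable in the sense of the norm $\Phi(t)$" means: there exist constants $D,b>0$, depending only on the system parameters (including $\varepsilon_1,\varepsilon_2$), the gain and the setpoint (not on the particular solution), such that $\Phi(t)\le D\,\Phi(0)e^{-bt}$ for all $t\ge0$. *)

theory Defs
  imports "HOL-Analysis.Analysis"
begin

text \<open>
  Temperature fields are functions \<open>T x t\<close> of position and time, of which only the values on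
  the moving domain \<open>0 \<le> x \<le> s t\<close>, \<open>t \<ge> 0\<close> are relevant.
\<close>

definition flux_law ::
  "real \<Rightarrow> real \<Rightarrow> real \<Rightarrow> real \<Rightarrow> real \<Rightarrow> real \<Rightarrow> (real \<Rightarrow> real) \<Rightarrow> real \<Rightarrow> real" where
  "flux_law \<alpha> \<beta> k c Tm sr u l =
     - c * k * (1 / \<alpha> * integral {0..l} (\<lambda>x. u x - Tm) + 1 / \<beta> * (l - sr))"

text \<open>
  A function belongs to \<open>H\<^sub>1(0,l)\<close> iff it is the indefinite integral of a square-integrable
  \<open>g\<close>.  In that case its pointwise derivative exists and equals \<open>g\<close> almost everywhere, so that
  \<open>deriv\<close> yields the usual norm.  The value of \<open>deriv\<close> at the end points, where \<open>u\<close> need not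
  be differentiable from both sides, does not affect the integral.
\<close>

definition in_H1 :: "real \<Rightarrow> (real \<Rightarrow> real) \<Rightarrow> bool" where
  "in_H1 l u \<longleftrightarrow>
     (\<exists>g. g absolutely_integrable_on {0..l} \<and> (\<lambda>x. (g x)\<^sup>2) integrable_on {0..l} \<and>
          (\<forall>x\<in>{0..l}. u x = u 0 + integral {0..x} g))"

definition L2_norm_sq :: "real \<Rightarrow> (real \<Rightarrow> real) \<Rightarrow> real" where
  "L2_norm_sq l u = integral {0..l} (\<lambda>x. (u x)\<^sup>2)"

definition H1_norm_sq :: "real \<Rightarrow> (real \<Rightarrow> real) \<Rightarrow> real" where
  "H1_norm_sq l u = L2_norm_sq l u + L2_norm_sq l (deriv u)"

text \<open>
  Classical solutions of the closed loop for \<open>t \<ge> 0\<close>.  The field is continuous on the whole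
  closed moving domain and, for \<open>t > 0\<close>, of class \<open>C\<^sup>2\<close> in space and \<open>C\<^sup>1\<close> in time up to both
  lateral boundaries; derivatives are taken relative to the moving domain, hence one-sided where
  necessary.  If \<open>x = s t\<close> is such that \<open>t\<close> is isolated in \<open>{\<tau>. x \<le> s \<tau>}\<close>, then the derivative
  condition for \<open>Tt\<close> is void there, and \<open>Tt x t\<close> is determined by continuity.

  No differentiability is required at \<open>t = 0\<close>, since this would impose compatibility conditions
  on \<open>T0\<close>.  Instead, the initial datum lies in \<open>H\<^sub>1\<close> and is attained in \<open>H\<^sub>1\<close>.  As \<open>T\<close> is
  continuous down to \<open>t = 0\<close>, convergence of the \<open>H\<^sub>1\<close> norms amounts to the latter; it is
  automatic if the spatial derivative is continuous down to \<open>t = 0\<close>.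
\<close>

definition closed_loop_solution ::
  "real \<Rightarrow> real \<Rightarrow> real \<Rightarrow> real \<Rightarrow> real \<Rightarrow> real \<Rightarrow> real \<Rightarrow> real \<Rightarrow> (real \<Rightarrow> real) \<Rightarrow> real \<Rightarrow>
   (real \<Rightarrow> real \<Rightarrow> real) \<Rightarrow> (real \<Rightarrow> real) \<Rightarrow> bool" where
  "closed_loop_solution \<alpha> \<beta> k c \<epsilon>\<^sub>1 \<epsilon>\<^sub>2 Tm sr T0 s0 T s \<longleftrightarrow>
     continuous_on {0..} s \<and> (\<forall>t\<ge>0. 0 < s t) \<and>
     continuous_on {(x, t). 0 \<le> t \<and> 0 \<le> x \<and> x \<le> s t} (\<lambda>(x, t). T x t) \<and>
     s 0 = s0 \<and> (\<forall>x\<in>{0..s0}. T x 0 = T0 x) \<and>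
     in_H1 s0 T0 \<and>
     ((\<lambda>t. H1_norm_sq (s t) (\<lambda>x. T x t - Tm)) \<longlongrightarrow> H1_norm_sq (s 0) (\<lambda>x. T x 0 - Tm))
       (at_right 0) \<and>
     (\<exists>Tx Txx Tt :: real \<Rightarrow> real \<Rightarrow> real.
        (\<forall>F\<in>{Tx, Txx, Tt}.
           continuous_on {(x, t). 0 < t \<and> 0 \<le> x \<and> x \<le> s t} (\<lambda>(x, t). F x t)) \<and>
        (\<forall>t>0. \<forall>x\<in>{0..s t}.
           ((\<lambda>y. T y t) has_real_derivative Tx x t) (at x within {0..s t}) \<and>
           ((\<lambda>y. Tx y t) has_real_derivative Txx x t) (at x within {0..s t}) \<and>
           ((\<lambda>\<tau>. T x \<tau>) has_real_derivative Tt x t) (at t within {\<tau>. 0 \<le> \<tau> \<and> x \<le> s \<tau>}) \<and>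
           Tt x t = \<alpha> * (1 + \<epsilon>\<^sub>1) * Txx x t) \<and>
        (\<forall>t>0.
           - k * Tx 0 t = flux_law \<alpha> \<beta> k c Tm sr (\<lambda>x. T x t) (s t) \<and>
           T (s t) t = Tm \<and>
           (s has_real_derivative - \<beta> * (1 + \<epsilon>\<^sub>2) * Tx (s t) t) (at t)))"

definition gain_bound :: "real \<Rightarrow> real \<Rightarrow> real \<Rightarrow> real" where
  "gain_bound \<alpha> sr c = (3 / 10) powr (1 / 4) * (\<alpha> / (8 * sr\<^sup>2 * c))"

definition perturbation_region :: "real \<Rightarrow> real \<Rightarrow> real \<Rightarrow> (real \<times> real) set" where
  "perturbation_region \<alpha> sr c =
     {(\<epsilon>\<^sub>1, \<epsilon>\<^sub>2). (1 - gain_bound \<alpha> sr c) * \<epsilon>\<^sub>1 - gain_bound \<alpha> sr c \<le> \<epsilon>\<^sub>2 \<and> \<epsilon>\<^sub>2 \<le> \<epsilon>\<^sub>1}"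

definition stability_norm ::
  "real \<Rightarrow> real \<Rightarrow> (real \<Rightarrow> real \<Rightarrow> real) \<Rightarrow> (real \<Rightarrow> real) \<Rightarrow> real \<Rightarrow> real" where
  "stability_norm Tm sr T s t = H1_norm_sq (s t) (\<lambda>x. T x t - Tm) + (s t - sr)\<^sup>2"

end

theory Submission
  imports Defs
begin

text \<open>
  Let \<open>e = - ((1/\<alpha>) \<integral> (T - Tm) + (s - sr)/\<beta>)\<close> be the control error and \<open>p = - T\<^sub>x(s(t), t)\<close>.  Then
  \<open>e' = - (1 + \<epsilon>\<^sub>1) c e + (\<epsilon>\<^sub>1 - \<epsilon>\<^sub>2) p\<close>.  As long as \<open>e > 0\<close> heat flows in, so the maximum principle
  gives \<open>T \<ge> Tm\<close> and \<open>p \<ge> 0\<close>; with \<open>\<epsilon>\<^sub>2 \<le> \<epsilon>\<^sub>1\<close> this keeps \<open>e\<close> above a decaying exponential, so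
  \<open>e\<close> never vanishes, and therefore \<open>s < sr\<close>.

  For a suitable \<open>A > 1\<close> the quantity \<open>V = (1/\<alpha>) \<integral> (T - Tm) + A e\<close> satisfies
  \<open>(V\<^sup>2)' \<le> - k\<^sub>3 e\<^sup>2\<close>.  With \<open>R = \<parallel>T\<^sub>x\<parallel>\<^sup>2\<close>, the corrected energy \<open>W = R - 2 c e (T(0, t) - Tm)\<close> satisfies
  \<open>W' \<le> - k\<^sub>1 R + k\<^sub>2 e\<^sup>2\<close>: the correction removes the boundary term \<open>T\<^sub>t(0, t)\<close>, and the term with
  \<open>e' (T(0, t) - Tm)\<close> left behind is at most a small multiple of \<open>R\<close> plus a multiple of \<open>e\<^sup>2\<close>.  Hence \<open>B V\<^sup>2 + W\<close> decays exponentially for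
  large \<open>B\<close>, and it is equivalent to \<open>R + e\<^sup>2\<close>, which is equivalent to the norm of the theorem.
  All constants depend on \<open>s\<close> only through the bound \<open>s < sr\<close>.
\<close>

section \<open>Calculus on the unit interval\<close>

text \<open>Cauchy-Schwarz with the length of the interval estimated away: with
  \<open>q = f y - f x\<close>, integrating \<open>(g z - q)\<^sup>2 \<ge> 0\<close> over
  \<open>{x..y}\<close> gives \<open>q\<^sup>2 * (2 - (y - x)) \<le> \<integral> g\<^sup>2\<close>,
  and \<open>y - x \<le> 1\<close>.\<close>

lemma square_diff_le_integral_square_deriv:
  fixes f g :: "real \<Rightarrow> real"
  assumes f: "\<And>z. z \<in> {0..1} \<Longrightarrow> (f has_real_derivative g z) (at z within {0..1})"
    and g: "continuous_on {0..1} g"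
    and xy: "x \<in> {0..1}" "y \<in> {0..1}"
  shows "(f y - f x)\<^sup>2 \<le> integral {0..1} (\<lambda>z. (g z)\<^sup>2)"
proof -
  have le: "(f y - f x)\<^sup>2 \<le> integral {0..1} (\<lambda>z. (g z)\<^sup>2)"
    if xy: "0 \<le> x" "x \<le> y" "y \<le> 1" for x y
  proof -
    have sub: "{x..y} \<subseteq> {0..1}" using xy by auto
    have gc: "continuous_on {x..y} g" using g sub continuous_on_subset by blast
    have "(g has_integral f y - f x) {x..y}"
      by (rule fundamental_theorem_of_calculus)
        (use xy in \<open>auto intro!: DERIV_subset[OF f] simp flip: has_real_derivative_iff_has_vector_derivative\<close>)
    note I = this
    define q where "q = f y - f x"
    have J: "((\<lambda>z. (g z)\<^sup>2) has_integral integral {x..y} (\<lambda>z. (g z)\<^sup>2)) {x..y}"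
      by (intro integrable_integral integrable_continuous_interval continuous_intros gc)
    have "((\<lambda>z. (g z)\<^sup>2 - (2 * q) * g z + q\<^sup>2) has_integral
        (integral {x..y} (\<lambda>z. (g z)\<^sup>2) - (2 * q) * q + (y - x) *\<^sub>R q\<^sup>2)) {x..y}"
      using has_integral_const_real[of "q\<^sup>2" x y] xy
      by (intro has_integral_add has_integral_diff has_integral_mult_right J)
        (simp_all add: I q_def)
    moreover have "(\<lambda>z. (g z)\<^sup>2 - (2 * q) * g z + q\<^sup>2) = (\<lambda>z. (g z - q)\<^sup>2)"
      by (auto simp: power2_eq_square algebra_simps)
    ultimately have "0 \<le> integral {x..y} (\<lambda>z. (g z)\<^sup>2) - (2 * q) * q + (y - x) *\<^sub>R q\<^sup>2"
      using has_integral_nonneg[of _ _ "{x..y}"] by (metis (lifting) zero_le_power2)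
    then have "q\<^sup>2 * (2 - (y - x)) \<le> integral {x..y} (\<lambda>z. (g z)\<^sup>2)"
      by (simp add: algebra_simps power2_eq_square)
    moreover have "q\<^sup>2 * 1 \<le> q\<^sup>2 * (2 - (y - x))"
      using xy by (intro mult_left_mono) auto
    moreover have "integral {x..y} (\<lambda>z. (g z)\<^sup>2) \<le> integral {0..1} (\<lambda>z. (g z)\<^sup>2)"
      by (rule integral_subset_le[OF sub])
        (auto intro!: integrable_continuous_interval continuous_intros gc g)
    ultimately show ?thesis by (simp add: q_def)
  qed
  show ?thesis
    using le[of x y] le[of y x] xy by (cases "x \<le> y") (auto simp: power2_commute)
qed

text \<open>Serves chain rules for functions known only through their partial derivatives: the one
  in \<open>x\<close> enters at the base point alone, the one in \<open>y\<close> on the whole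
  product, with continuity at the base point.\<close>

lemma has_derivative_real_partials:
  fixes f :: "real \<Rightarrow> real \<Rightarrow> real"
  assumes fx: "((\<lambda>x. f x y) has_real_derivative d) (at x within X)"
    and fy: "\<And>x y. x \<in> X \<Longrightarrow> y \<in> Y \<Longrightarrow> ((\<lambda>y. f x y) has_real_derivative fy x y) (at y within Y)"
    and cont: "continuous (at (x, y) within X \<times> Y) (\<lambda>(x, y). fy x y)"
    and "y \<in> Y" "convex Y"
  shows "((\<lambda>(x, y). f x y) has_derivative (\<lambda>(u, v). d * u + fy x y * v)) (at (x, y) within X \<times> Y)"
proof -
  have "((\<lambda>(x, y). f x y) has_derivative
      (\<lambda>(u, v). d * u + blinfun_apply (blinfun_mult_right (fy x y)) v)) (at (x, y) within X \<times> Y)"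
  proof (rule has_derivative_partialsI[where fy = "\<lambda>x y. blinfun_mult_right (fy x y)"])
    show "((\<lambda>x. f x y) has_derivative (*) d) (at x within X)"
      using fx by (simp add: has_field_derivative_def)
    show "((\<lambda>y. f x y) has_derivative blinfun_apply (blinfun_mult_right (fy x y))) (at y within Y)"
      if "x \<in> X" "y \<in> Y" for x y
      using fy[OF that] by (simp add: has_field_derivative_def)
    have "continuous (at (x, y) within X \<times> Y) (\<lambda>z. blinfun_mult_right ((\<lambda>(x, y). fy x y) z))"
      by (rule bounded_linear.continuous[OF bounded_linear_blinfun_mult_right cont])
    then show "continuous (at (x, y) within X \<times> Y) (\<lambda>(x, y). blinfun_mult_right (fy x y))"
      by (simp add: case_prod_unfold)
  qed (use assms in auto)
  then show ?thesis by simp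
qed

text \<open>Symmetry turns the derivative in the first argument into one in the second, so
  \<open>B\<close> is jointly differentiable at \<open>(t, t)\<close>; the chain rule along the
  diagonal adds two equal partials.\<close>

lemma has_real_derivative_diagonal:
  fixes B D :: "real \<Rightarrow> real \<Rightarrow> real"
  assumes U: "open U" "convex U" "t \<in> U"
    and sym: "\<And>t t'. B t t' = B t' t"
    and B: "\<And>t t'. t \<in> U \<Longrightarrow> t' \<in> U \<Longrightarrow> ((\<lambda>t. B t t') has_real_derivative D t t') (at t)"
    and D: "continuous_on (U \<times> U) (\<lambda>(t, t'). D t t')"
  shows "((\<lambda>t. B t t) has_real_derivative 2 * D t t) (at t)"
proof -
  have "continuous_on (U \<times> U) ((\<lambda>(t, t'). D t t') \<circ> prod.swap)"
    by (rule continuous_on_compose) (simp_all add: continuous_on_swap product_swap D)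
  then have D': "continuous_on (U \<times> U) (\<lambda>(t, t'). D t' t)"
    by (simp add: case_prod_unfold o_def)
  have "((\<lambda>(x, y). B x y) has_derivative (\<lambda>(u, v). D t t * u + D t t * v)) (at (t, t) within U \<times> U)"
  proof (rule has_derivative_real_partials[where fy = "\<lambda>x y. D y x"])
    show "((\<lambda>y. B x y) has_real_derivative D y x) (at y within U)" if "x \<in> U" "y \<in> U" for x y
    proof -
      have "(\<lambda>y. B x y) = (\<lambda>y. B y x)" using sym by blast
      then show ?thesis using has_field_derivative_at_within[OF B[OF that(2,1)]] by simp
    qed
    show "continuous (at (t, t) within U \<times> U) (\<lambda>(x, y). D y x)"
      using D' U(3) unfolding continuous_on_eq_continuous_within by blast
  next
    show "((\<lambda>x. B x t) has_real_derivative D t t) (at t within U)"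
      by (rule has_field_derivative_at_within[OF B[OF U(3) U(3)]])
  qed (rule U)+
  moreover have "at (t, t) within U \<times> U = at (t, t)"
    by (rule at_within_open) (simp_all add: U(1,3) open_Times)
  ultimately have "((\<lambda>(x, y). B x y) has_derivative (\<lambda>(u, v). D t t * u + D t t * v)) (at (t, t))"
    by simp
  moreover have "((\<lambda>t. (t, t)) has_derivative (\<lambda>u. (u, u))) (at t)"
    by (intro has_derivative_Pair has_derivative_ident)
  ultimately have "((\<lambda>(x, y). B x y) \<circ> (\<lambda>t. (t, t)) has_derivative
      (\<lambda>(u, v). D t t * u + D t t * v) \<circ> (\<lambda>u. (u, u))) (at t)"
    by (intro diff_chain_at)
  moreover have "(\<lambda>(u, v). D t t * u + D t t * v) \<circ> (\<lambda>u. (u, u)) = (*) (2 * D t t)"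
    by (rule ext) simp
  ultimately show ?thesis
    by (simp add: has_field_derivative_def o_def)
qed

text \<open>The mean value estimate is uniform in \<open>y\<close> and hence survives the limit at \<open>y = 1\<close>.\<close>

lemma has_real_derivative_limit_endpoint:
  fixes v w :: "real \<Rightarrow> real \<Rightarrow> real"
  assumes I: "open I" "t \<in> I"
    and v: "continuous_on ({0..1} \<times> I) (\<lambda>(y, t). v y t)"
    and w: "continuous_on ({0..1} \<times> I) (\<lambda>(y, t). w y t)"
    and vw: "\<And>y t. 0 \<le> y \<Longrightarrow> y < 1 \<Longrightarrow> t \<in> I \<Longrightarrow> ((\<lambda>t. v y t) has_real_derivative w y t) (at t)"
  shows "((\<lambda>t. v 1 t) has_real_derivative w 1 t) (at t)"
proof -
  obtain r where r: "r > 0" "cball t r \<subseteq> I" using I open_contains_cball by blast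
  have ywithin: "((\<lambda>y. F y \<tau>) \<longlongrightarrow> F 1 \<tau>) (at_left 1)"
    if F: "continuous_on ({0..1} \<times> I) (\<lambda>(y, t). F y t)" and \<tau>: "\<tau> \<in> I"
    for F :: "real \<Rightarrow> real \<Rightarrow> real" and \<tau>
  proof -
    have "continuous_on {0..1} ((\<lambda>(y, t). F y t) \<circ> (\<lambda>y. (y, \<tau>)))"
      by (rule continuous_on_compose)
        (use \<tau> in \<open>auto intro!: continuous_intros intro: continuous_on_subset[OF F]\<close>)
    then have "((\<lambda>y. F y \<tau>) \<longlongrightarrow> F 1 \<tau>) (at 1 within {0..1})"
      by (auto simp: continuous_on o_def)
    then show ?thesis
      by (simp add: at_within_Icc_at_left)
  qed
  have "uniformly_continuous_on ({0..1} \<times> cball t r) (\<lambda>(y, t). w y t)"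
    by (rule compact_uniformly_continuous)
      (use r in \<open>auto intro!: compact_Times intro: continuous_on_subset[OF w]\<close>)
  note uc = this[unfolded uniformly_continuous_on_def]
  have "\<exists>d>0. \<forall>\<tau>. norm (\<tau> - t) < d \<longrightarrow> norm (v 1 \<tau> - v 1 t - w 1 t * (\<tau> - t)) \<le> e * norm (\<tau> - t)"
    if "e > 0" for e
  proof -
    obtain d where d: "d > 0" and dd: "\<And>p q. p \<in> {0..1} \<times> cball t r \<Longrightarrow> q \<in> {0..1} \<times> cball t r \<Longrightarrow>
        dist q p < d \<Longrightarrow> dist ((\<lambda>(y, t). w y t) q) ((\<lambda>(y, t). w y t) p) < e"
      using uc[rule_format, OF \<open>e > 0\<close>] by blast
    have "norm (v 1 \<tau> - v 1 t - w 1 t * (\<tau> - t)) \<le> e * norm (\<tau> - t)"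
      if \<tau>: "norm (\<tau> - t) < min d r" for \<tau>
    proof -
      have cb: "\<tau> \<in> I" using r \<tau> by (auto simp: subset_iff dist_norm norm_minus_commute)
      have est: "norm (v y \<tau> - v y t - w y t * (\<tau> - t)) \<le> e * norm (\<tau> - t)" if y: "0 \<le> y" "y < 1" for y
      proof -
        \<comment> \<open>Subtracting the linear term leaves the derivative
          \<open>w y z - w y t\<close>, which is below \<open>e\<close> with the same
          \<open>d\<close> for every \<open>y\<close>.\<close>
        have "norm ((v y \<tau> - w y t * \<tau>) - (v y t - w y t * t)) \<le> e * norm (\<tau> - t)"
        proof (rule field_differentiable_bound[where S = "closed_segment t \<tau>"])
          fix z assume z: "z \<in> closed_segment t \<tau>"
          then have zd: "norm (z - t) \<le> norm (\<tau> - t)" by (rule segment_bound1)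
          then have zr: "z \<in> cball t r" using \<tau> by (auto simp: dist_norm norm_minus_commute)
          show "((\<lambda>t'. v y t' - w y t * t') has_field_derivative w y z - w y t) (at z within closed_segment t \<tau>)"
          proof -
            have "(v y has_real_derivative w y z) (at z)" using vw[OF y, of z] zr r by auto
            from DERIV_diff[OF this DERIV_cmult[OF DERIV_ident, of "w y t" z]]
            show ?thesis by (auto intro: has_field_derivative_at_within)
          qed
          have "dist (w y z) (w y t) < e"
            using dd[of "(y, t)" "(y, z)"] zr zd \<tau> y r by (auto simp: dist_Pair_Pair dist_norm)
          then show "norm (w y z - w y t) \<le> e" by (simp add: dist_norm)
        qed auto
        then show ?thesis by (simp add: algebra_simps)
      qed
      have "((\<lambda>y. norm (v y \<tau> - v y t - w y t * (\<tau> - t))) \<longlongrightarrow> norm (v 1 \<tau> - v 1 t - w 1 t * (\<tau> - t))) (at_left 1)"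
        by (intro tendsto_intros ywithin[OF v] ywithin[OF w] cb I)
      moreover have "\<forall>\<^sub>F y in at_left (1::real). norm (v y \<tau> - v y t - w y t * (\<tau> - t)) \<le> e * norm (\<tau> - t)"
        using eventually_at_left_real[of 0 "1::real"] by (rule eventually_mono) (use est in auto)
      ultimately show ?thesis
        by (rule tendsto_upperbound) simp
    qed
    then show ?thesis using d r by (intro exI[of _ "min d r"]) auto
  qed
  then show ?thesis
    unfolding has_field_derivative_def has_derivative_at_alt by (auto intro: bounded_linear_mult_right)
qed

lemma continuous_on_uncurried_compose:
  assumes "continuous_on (A \<times> B) (\<lambda>(x, y). F x y)" "continuous_on X g" "continuous_on X h"
    and "\<And>z. z \<in> X \<Longrightarrow> g z \<in> A" "\<And>z. z \<in> X \<Longrightarrow> h z \<in> B"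
  shows "continuous_on X (\<lambda>z. F (g z) (h z))"
proof -
  have "continuous_on X (\<lambda>z. (\<lambda>(x, y). F x y) (g z, h z))"
    by (rule continuous_on_compose2[OF assms(1) continuous_on_Pair[OF assms(2,3)]]) (use assms in auto)
  then show ?thesis by simp
qed

text \<open>A negative second derivative would make \<open>f'\<close> negative just to the right of
  the critical point \<open>x\<close>, and \<open>f\<close> would drop below its minimum
  there.\<close>

lemma nonneg_second_deriv_at_min:
  fixes f f' :: "real \<Rightarrow> real"
  assumes x: "a < x" "x < b"
    and f: "\<And>z. z \<in> {a..b} \<Longrightarrow> (f has_real_derivative f' z) (at z within {a..b})"
    and f': "(f' has_real_derivative d) (at x within {a..b})"
    and min: "\<And>z. z \<in> {a..b} \<Longrightarrow> f x \<le> f z"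
  shows "f' x = 0" "d \<ge> 0"
proof -
  have atf: "(f has_real_derivative f' z) (at z)" if "a < z" "z < b" for z
    using f[of z] that by (simp add: at_within_Icc_at)
  have atf': "(f' has_real_derivative d) (at x)"
    using f' x by (simp add: at_within_Icc_at)
  show 0: "f' x = 0"
  proof (rule DERIV_local_min[OF atf[OF x]])
    show "0 < min (x - a) (b - x)" using x by simp
    show "\<forall>y. \<bar>x - y\<bar> < min (x - a) (b - x) \<longrightarrow> f x \<le> f y"
      using min by (auto simp: abs_less_iff)
  qed
  show "d \<ge> 0"
  proof (rule ccontr)
    assume "\<not> d \<ge> 0"
    then have "d < 0" by simp
    from DERIV_neg_dec_right[OF atf' this] obtain h where h: "h > 0"
      and dec: "\<And>k. k > 0 \<Longrightarrow> k < h \<Longrightarrow> f' (x + k) < 0" using 0 by auto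
    define k where "k = min (h / 2) ((b - x) / 2)"
    have k: "k > 0" "k < h" "x + k < b" using h x by (auto simp: k_def min_def field_simps)
    have "f (x + k) < f x"
    proof (rule DERIV_neg_imp_decreasing_open[of x "x + k" f])
      show "x < x + k" using k by simp
      show "\<exists>y. (f has_real_derivative y) (at z) \<and> y < 0" if "x < z" "z < x + k" for z
        using atf[of z] dec[of "z - x"] that k x by (intro exI[of _ "f' z"]) auto
      show "continuous_on {x..x + k} f"
        by (rule DERIV_atLeastAtMost_imp_continuous_on) (use k x in \<open>auto intro!: exI atf\<close>)
    qed
    with min[of "x + k"] k x show False by auto
  qed
qed

section \<open>Positivity and the control error\<close>

text \<open>
  The substitution \<open>x = y s(t)\<close> fixes the domain: \<open>v y t\<close> stands for \<open>T (y * s t) t - Tm\<close>, and \<open>vy\<close>,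
  \<open>vyy\<close> for its \<open>y\<close>-derivatives.  \<open>s'\<close> and \<open>w\<close> are the time derivatives of \<open>s\<close> and \<open>v\<close> that the
  Stefan condition and the heat equation prescribe, \<open>p\<close> is \<open>- T\<^sub>x\<close> at the interface, and the boundary
  flux is \<open>k c e\<close>.
\<close>

locale straightened_data =
  fixes \<alpha> \<beta> c \<epsilon>\<^sub>1 \<epsilon>\<^sub>2 sr :: real and s :: "real \<Rightarrow> real" and v vy vyy :: "real \<Rightarrow> real \<Rightarrow> real"
begin

definition p :: "real \<Rightarrow> real" where "p t = - vy 1 t / s t"
definition s' :: "real \<Rightarrow> real" where "s' t = \<beta> * (1 + \<epsilon>\<^sub>2) * p t"
definition w :: "real \<Rightarrow> real \<Rightarrow> real" where
  "w y t = \<alpha> * (1 + \<epsilon>\<^sub>1) * vyy y t / (s t)\<^sup>2 + y * s' t / s t * vy y t"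
definition m :: "real \<Rightarrow> real" where "m t = s t * integral {0..1} (\<lambda>y. v y t)"
definition e :: "real \<Rightarrow> real" where "e t = - (m t / \<alpha> + (s t - sr) / \<beta>)"
definition N :: "real \<Rightarrow> real" where "N t = integral {0..1} (\<lambda>y. (vy y t)\<^sup>2)"
definition Y :: "real \<Rightarrow> real" where "Y t = integral {0..1} (\<lambda>y. (vyy y t)\<^sup>2)"

end

text \<open>Time differentiability is assumed only for \<open>y < 1\<close>: at \<open>y = 1\<close>
  the point lies on the interface, where the time derivative at fixed position may be void.
  \<open>v_time_deriv\<close> recovers it there as a limit.\<close>

locale straightened_loop = straightened_data +
  assumes par: "\<alpha> > 0" "\<beta> > 0" "c > 0" "\<epsilon>\<^sub>1 > -1" "\<epsilon>\<^sub>2 > -1" "\<epsilon>\<^sub>2 \<le> \<epsilon>\<^sub>1"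
    and s_cont: "continuous_on {0..} s"
    and s_pos: "\<And>t. t \<ge> 0 \<Longrightarrow> s t > 0"
    and v_cont: "continuous_on ({0..1} \<times> {0..}) (\<lambda>(y, t). v y t)"
    and vy_cont: "continuous_on ({0..1} \<times> {0<..}) (\<lambda>(y, t). vy y t)"
    and vyy_cont: "continuous_on ({0..1} \<times> {0<..}) (\<lambda>(y, t). vyy y t)"
    and v_deriv: "\<And>y t. t > 0 \<Longrightarrow> y \<in> {0..1} \<Longrightarrow>
      ((\<lambda>y. v y t) has_real_derivative vy y t) (at y within {0..1})"
    and vy_deriv: "\<And>y t. t > 0 \<Longrightarrow> y \<in> {0..1} \<Longrightarrow>
      ((\<lambda>y. vy y t) has_real_derivative vyy y t) (at y within {0..1})"
    and v_time_deriv': "\<And>y t. t > 0 \<Longrightarrow> 0 \<le> y \<Longrightarrow> y < 1 \<Longrightarrow> (v y has_real_derivative w y t) (at t)"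
    and s_deriv: "\<And>t. t > 0 \<Longrightarrow> (s has_real_derivative s' t) (at t)"
    and v_one: "\<And>t. t \<ge> 0 \<Longrightarrow> v 1 t = 0"
    and flux: "\<And>t. t > 0 \<Longrightarrow> vy 0 t = - s t * c * e t"
    and init: "\<And>y. y \<in> {0..1} \<Longrightarrow> v y 0 \<ge> 0" "e 0 > 0"
begin

section \<open>Regularity in fixed coordinates\<close>

lemma s_nz: "t \<ge> 0 \<Longrightarrow> s t \<noteq> 0" using s_pos by force

lemmas v_comp = continuous_on_uncurried_compose[OF v_cont]
lemmas vy_comp = continuous_on_uncurried_compose[OF vy_cont]
lemmas vyy_comp = continuous_on_uncurried_compose[OF vyy_cont]

lemma s_comp: "continuous_on X h \<Longrightarrow> (\<And>z. z \<in> X \<Longrightarrow> h z \<ge> 0) \<Longrightarrow> continuous_on X (\<lambda>z. s (h z))"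
  by (rule continuous_on_compose2[OF s_cont]) auto

lemma s'_comp:
  assumes "continuous_on X h" "\<And>z. z \<in> X \<Longrightarrow> h z > 0"
  shows "continuous_on X (\<lambda>z. s' (h z))"
  unfolding s'_def p_def using assms s_nz
  by (intro continuous_intros vy_comp s_comp) (auto intro: less_imp_le simp: less_imp_neq)

lemma w_comp:
  assumes "continuous_on X g" "continuous_on X h"
    and "\<And>z. z \<in> X \<Longrightarrow> g z \<in> {0..1}" "\<And>z. z \<in> X \<Longrightarrow> h z \<in> {0<..}"
  shows "continuous_on X (\<lambda>z. w (g z) (h z))"
  unfolding w_def using assms s_nz
  by (intro continuous_intros vy_comp vyy_comp s_comp s'_comp) (auto intro: less_imp_le)

lemma w_cont: "continuous_on ({0..1} \<times> {0<..}) (\<lambda>(y, t). w y t)"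
proof -
  have "continuous_on ({0..1} \<times> {0<..}) (\<lambda>z. w (fst z) (snd z))"
    by (rule w_comp) (auto intro!: continuous_intros)
  then show ?thesis by (simp add: case_prod_unfold)
qed

lemma v_time_deriv:
  assumes "t > 0" "y \<in> {0..1}"
  shows "(v y has_real_derivative w y t) (at t)"
proof (cases "y < 1")
  case True
  then show ?thesis using v_time_deriv' assms by auto
next
  case False
  have "((\<lambda>t. v 1 t) has_real_derivative w 1 t) (at t)"
  proof (rule has_real_derivative_limit_endpoint[where I = "{0<..}"])
    show "continuous_on ({0..1} \<times> {0<..}) (\<lambda>(y, t). v y t)"
      by (rule continuous_on_subset[OF v_cont]) auto
  qed (use assms v_time_deriv' w_cont in auto)
  then show ?thesis using False assms by simp
qed

section \<open>Heat balance and the control error\<close>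

lemma m_deriv:
  assumes t: "t > 0"
  shows "(m has_real_derivative \<alpha> * (1 + \<epsilon>\<^sub>1) * (c * e t - p t)) (at t)"
proof -
  have "((\<lambda>t. integral (cbox 0 1) (\<lambda>y. v y t)) has_real_derivative
      integral (cbox 0 1) (\<lambda>y. w y t)) (at t within {0<..})"
  proof (rule leibniz_rule_field_derivative)
    show "((\<lambda>t. v y t) has_real_derivative w y t) (at t within {0<..})"
      if "t \<in> {0<..}" "y \<in> cbox 0 1" for t y
      by (rule has_field_derivative_at_within[OF v_time_deriv]) (use that in auto)
    show "(\<lambda>y. v y t) integrable_on cbox 0 1" if "t \<in> {0<..}" for t
      using that by (intro integrable_continuous v_comp continuous_intros) auto
    have "continuous_on ({0<..} \<times> cbox 0 1) (\<lambda>z. w (snd z) (fst z))"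
      by (rule w_comp) (auto intro!: continuous_intros)
    then show "continuous_on ({0<..} \<times> cbox 0 1) (\<lambda>(t, y). w y t)" by (simp add: case_prod_unfold)
  qed (use t in auto)
  then have I: "((\<lambda>t. integral {0..1} (\<lambda>y. v y t)) has_real_derivative integral {0..1} (\<lambda>y. w y t)) (at t)"
    using t by (simp add: at_within_open[of t "{0<..}"])
  define V where "V = integral {0..1} (\<lambda>y. v y t)"
  have vI: "((\<lambda>y. v y t) has_integral V) {0..1}"
    unfolding V_def using t
    by (intro integrable_integral integrable_continuous_interval v_comp continuous_intros) auto
  have a: "((\<lambda>y. vyy y t) has_integral vy 1 t - vy 0 t) {0..1}"
    by (rule fundamental_theorem_of_calculus)
      (use t vy_deriv in \<open>auto simp flip: has_real_derivative_iff_has_vector_derivative\<close>)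
  \<comment> \<open>Integration by parts for the transport term: the boundary value vanishes at
    \<open>y = 0\<close> through the factor \<open>y\<close> and at \<open>y = 1\<close> because
    \<open>v 1 t = 0\<close>.\<close>
  have "((\<lambda>y. v y t + y * vy y t) has_integral 1 * v 1 t - 0 * v 0 t) {0..1}"
  proof (rule fundamental_theorem_of_calculus)
    fix y :: real assume y: "y \<in> {0..1}"
    from DERIV_mult'[OF DERIV_ident v_deriv[OF t y]]
    show "((\<lambda>y. y * v y t) has_vector_derivative v y t + y * vy y t) (at y within {0..1})"
      by (simp add: add.commute flip: has_real_derivative_iff_has_vector_derivative)
  qed simp
  from has_integral_diff[OF this vI] have b: "((\<lambda>y. y * vy y t) has_integral - V) {0..1}"
    using t by (simp add: v_one)
  have "((\<lambda>y. \<alpha> * (1 + \<epsilon>\<^sub>1) / (s t)\<^sup>2 * vyy y t + s' t / s t * (y * vy y t)) has_integral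
      (\<alpha> * (1 + \<epsilon>\<^sub>1) / (s t)\<^sup>2 * (vy 1 t - vy 0 t) + s' t / s t * - V)) {0..1}"
    by (intro has_integral_add has_integral_mult_right a b)
  moreover have "(\<lambda>y. \<alpha> * (1 + \<epsilon>\<^sub>1) / (s t)\<^sup>2 * vyy y t + s' t / s t * (y * vy y t)) = (\<lambda>y. w y t)"
    by (auto simp: w_def)
  ultimately have W: "integral {0..1} (\<lambda>y. w y t) =
      \<alpha> * (1 + \<epsilon>\<^sub>1) / (s t)\<^sup>2 * (vy 1 t - vy 0 t) + s' t / s t * - V"
    by (simp add: integral_unique)
  have p: "vy 1 t = - s t * p t" using s_nz[of t] t by (simp add: p_def)
  \<comment> \<open>The transport term yields \<open>- s' t * V\<close>, which cancels the
    contribution of the factor \<open>s t\<close> in \<open>m\<close>; only the fluxes through the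
    two ends remain.\<close>
  have "s t * integral {0..1} (\<lambda>y. w y t) + s' t * V = \<alpha> * (1 + \<epsilon>\<^sub>1) * (c * e t - p t)"
    unfolding W p flux[OF t] using s_nz[of t] t by (simp add: field_simps power2_eq_square)
  then show ?thesis
    using DERIV_mult'[OF s_deriv[OF t] I] unfolding m_def[abs_def] V_def by simp
qed

text \<open>Heat leaving at the interface raises \<open>e\<close> by
  \<open>(1 + \<epsilon>\<^sub>1) * p\<close>, and the advance of the interface lowers it by
  \<open>(1 + \<epsilon>\<^sub>2) * p\<close>. The mismatch of the two perturbations is what
  survives.\<close>

lemma e_deriv:
  assumes t: "t > 0"
  shows "(e has_real_derivative - (1 + \<epsilon>\<^sub>1) * c * e t + (\<epsilon>\<^sub>1 - \<epsilon>\<^sub>2) * p t) (at t)"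
proof -
  have "((\<lambda>t. - (m t / \<alpha> + (s t - sr) / \<beta>)) has_real_derivative
      - (\<alpha> * (1 + \<epsilon>\<^sub>1) * (c * e t - p t) / \<alpha> + (s' t - 0) / \<beta>)) (at t)"
    by (intro DERIV_minus DERIV_add DERIV_cdivide DERIV_diff DERIV_const m_deriv s_deriv t)
  moreover have "e = (\<lambda>t. - (m t / \<alpha> + (s t - sr) / \<beta>))" by (simp add: e_def fun_eq_iff)
  moreover have "- (\<alpha> * (1 + \<epsilon>\<^sub>1) * (c * e t - p t) / \<alpha> + (s' t - 0) / \<beta>) =
      - (1 + \<epsilon>\<^sub>1) * c * e t + (\<epsilon>\<^sub>1 - \<epsilon>\<^sub>2) * p t"
    using par by (simp add: s'_def field_simps)
  ultimately show ?thesis by simp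
qed

lemma m_cont: "continuous_on {0..} m"
proof -
  have "continuous_on {0..} (\<lambda>t. integral (cbox 0 1) (\<lambda>y. v y t))"
  proof (rule integral_continuous_on_param)
    have "continuous_on ({0..} \<times> cbox 0 1) (\<lambda>z. v (snd z) (fst z))"
      by (rule v_comp) (auto intro!: continuous_intros)
    then show "continuous_on ({0..} \<times> cbox 0 1) (\<lambda>(t, y). v y t)" by (simp add: case_prod_unfold)
  qed
  then show ?thesis unfolding m_def[abs_def] by (auto intro!: continuous_intros s_cont)
qed

lemma e_cont: "continuous_on {0..} e"
  unfolding e_def[abs_def] using par by (auto intro!: continuous_intros s_cont m_cont)

section \<open>Maximum principle and positivity\<close>

lemma nonneg_while_error_pos:
  assumes epos: "\<And>t. 0 < t \<Longrightarrow> t \<le> \<tau> \<Longrightarrow> e t > 0"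
    and t: "0 \<le> t" "t \<le> \<tau>" and y: "y \<in> {0..1}"
  shows "v y t \<ge> 0"
proof -
  \<comment> \<open>At a negative minimum of \<open>v\<close> itself the time derivative would
    merely be nonnegative, which is no contradiction. The added \<open>\<delta> * t\<close> makes it
    strictly positive, against minimality with respect to earlier times.\<close>
  have bound: "v y t + \<delta> * t \<ge> 0" if \<delta>: "\<delta> > 0" for \<delta>
  proof -
    define f where "f = (\<lambda>z. v (fst z) (snd z) + \<delta> * snd z)"
    have "continuous_on ({0..1} \<times> {0..\<tau>}) f"
      unfolding f_def by (intro continuous_intros v_comp) auto
    moreover have "compact ({0..1::real} \<times> {0..\<tau>})" by (intro compact_Times compact_Icc)
    moreover have "{0..1::real} \<times> {0..\<tau>} \<noteq> {}" using t by auto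
    ultimately obtain z where "z \<in> {0..1} \<times> {0..\<tau>}" "\<And>z'. z' \<in> {0..1} \<times> {0..\<tau>} \<Longrightarrow> f z \<le> f z'"
      using continuous_attains_inf by metis
    then obtain y0 t0 where y0: "y0 \<in> {0..1}" and t0: "t0 \<in> {0..\<tau>}"
      and min: "\<And>y t. y \<in> {0..1} \<Longrightarrow> t \<in> {0..\<tau>} \<Longrightarrow> v y0 t0 + \<delta> * t0 \<le> v y t + \<delta> * t"
      by (cases z) (fastforce simp: f_def)
    have "v y0 t0 + \<delta> * t0 \<ge> 0"
    proof (rule ccontr)
      assume neg: "\<not> v y0 t0 + \<delta> * t0 \<ge> 0"
      have "t0 \<noteq> 0" using neg init(1)[OF y0] by auto
      then have t0': "t0 > 0" using t0 by auto
      have "y0 \<noteq> 1" using neg v_one[of t0] t0' \<delta> by auto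
      then have y1: "y0 < 1" using y0 by auto
      have miny: "v y0 t0 \<le> v y t0" if "y \<in> {0..1}" for y using min[OF that t0] by simp
      have "y0 \<noteq> 0"
      proof
        assume y00: "y0 = 0"
        \<comment> \<open>At the heated end the inflow makes \<open>v\<close> decrease into the
          domain, so the minimum cannot lie there.\<close>
        have "vy 0 t0 < 0"
          using flux[OF t0'] epos[of t0] t0 t0' s_pos[of t0] par by simp
        from has_real_derivative_neg_dec_right[OF v_deriv[OF t0', of 0] this]
        obtain d where d: "d > 0" "\<And>h. 0 < h \<Longrightarrow> 0 + h \<in> {0..1} \<Longrightarrow> h < d \<Longrightarrow> v (0 + h) t0 < v 0 t0"
          by auto
        have "v (min (d/2) 1) t0 < v 0 t0" using d(1) d(2)[of "min (d/2) 1"] by auto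
        then show False using miny[of "min (d/2) 1"] d(1) y00 by auto
      qed
      then have y00: "0 < y0" using y0 by auto
      note sd = nonneg_second_deriv_at_min[OF y00 y1 v_deriv[OF t0'] vy_deriv[OF t0' y0] miny]
      \<comment> \<open>At an interior minimum the transport term vanishes and the diffusion term is
        nonnegative.\<close>
      have "w y0 t0 \<ge> 0"
        unfolding w_def using sd par by simp
      then have pos: "w y0 t0 + \<delta> > 0" using \<delta> by simp
      have "((\<lambda>t. v y0 t + \<delta> * t) has_real_derivative w y0 t0 + \<delta> * 1) (at t0)"
        by (intro DERIV_add v_time_deriv t0' y0 DERIV_cmult DERIV_ident)
      then have "((\<lambda>t. v y0 t + \<delta> * t) has_real_derivative w y0 t0 + \<delta>) (at t0)" by simp
      from DERIV_pos_inc_left[OF this pos]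
      obtain d where d: "d > 0" "\<And>h. 0 < h \<Longrightarrow> h < d \<Longrightarrow> v y0 (t0 - h) + \<delta> * (t0 - h) < v y0 t0 + \<delta> * t0"
        by auto
      have "v y0 (t0 - min (d/2) t0) + \<delta> * (t0 - min (d/2) t0) < v y0 t0 + \<delta> * t0"
        using d(1) t0' by (intro d(2)) auto
      moreover have "t0 - min (d/2) t0 \<in> {0..\<tau>}" using d(1) t0 t0' by auto
      ultimately show False using min[OF y0] by fastforce
    qed
    then show ?thesis using min[OF y, of t] t by auto
  qed
  show ?thesis
  proof (rule ccontr)
    assume neg: "\<not> v y t \<ge> 0"
    \<comment> \<open>Small enough that \<open>\<delta> * t < - v y t\<close>; the
      \<open>+ 1\<close> keeps the quotient meaningful at \<open>t = 0\<close>.\<close>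
    define \<delta> where "\<delta> = - v y t / (2 * (t + 1))"
    have \<delta>: "\<delta> > 0" using t neg by (simp add: \<delta>_def divide_neg_pos)
    have "\<delta> * (2 * (t + 1)) = - v y t" using t by (simp add: \<delta>_def)
    then have "- v y t = 2 * (\<delta> * t) + 2 * \<delta>" by (simp add: algebra_simps)
    moreover have "\<delta> * t \<ge> 0" using \<delta> t by simp
    ultimately show False using bound[OF \<delta>] \<delta> by linarith
  qed
qed

text \<open>At the interface \<open>v\<close> vanishes and thus attains its minimum over the domain,
  so its one-sided slope there cannot be positive.\<close>

lemma p_nonneg:
  assumes t: "t > 0" and nonneg: "\<And>y. y \<in> {0..1} \<Longrightarrow> v y t \<ge> 0"
  shows "p t \<ge> 0"
proof -
  have "vy 1 t \<le> 0"
  proof (rule ccontr)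
    assume "\<not> vy 1 t \<le> 0"
    then have "vy 1 t > 0" by simp
    from has_real_derivative_pos_inc_left[OF v_deriv[OF t, of 1] this]
    obtain d where d: "d > 0" "\<And>h. 0 < h \<Longrightarrow> 1 - h \<in> {0..1} \<Longrightarrow> h < d \<Longrightarrow> v (1 - h) t < v 1 t"
      by auto
    have "v (1 - min (d/2) 1) t < v 1 t" using d(1) d(2)[of "min (d/2) 1"] by auto
    then show False using nonneg[of "1 - min (d/2) 1"] v_one[of t] t d(1) by auto
  qed
  then show ?thesis using s_pos[of t] t by (simp add: p_def divide_nonpos_pos)
qed

text \<open>Let \<open>\<tau>\<close> be the first time with \<open>e \<le> 0\<close>. Before
  \<open>\<tau>\<close> the maximum principle gives \<open>p \<ge> 0\<close>, so \<open>e\<close>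
  times the integrating factor \<open>exp ((1 + \<epsilon>\<^sub>1) * c * r)\<close> is
  nondecreasing up to \<open>\<tau>\<close> and stays above \<open>e 0 > 0\<close>.\<close>

lemma e_pos:
  assumes "t \<ge> 0"
  shows "e t > 0"
proof (rule ccontr)
  assume neg: "\<not> e t > 0"
  define S where "S = {0..t} \<inter> e -` {..0}"
  have "closed S"
    unfolding S_def by (intro continuous_closed_preimage continuous_on_subset[OF e_cont]) auto
  moreover have Sne: "S \<noteq> {}" and bdd: "bdd_below S"
    using assms neg by (auto simp: S_def intro: bdd_below_mono[of "{0..t}"])
  ultimately have IS: "Inf S \<in> S" by (rule_tac closed_contains_Inf)
  define \<tau> where "\<tau> = Inf S"
  have \<tau>: "0 \<le> \<tau>" "e \<tau> \<le> 0" "\<tau> \<le> t" using IS by (auto simp: S_def \<tau>_def)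
  have \<tau>0: "\<tau> > 0" using \<tau> init(2) by (cases "\<tau> = 0") auto
  have before: "e r > 0" if "0 \<le> r" "r < \<tau>" for r
    using cInf_lower[OF _ bdd, of r] that \<tau> by (force simp: S_def \<tau>_def)
  have "e 0 * exp ((1 + \<epsilon>\<^sub>1) * c * 0) \<le> e \<tau> * exp ((1 + \<epsilon>\<^sub>1) * c * \<tau>)"
  proof (rule DERIV_nonneg_imp_increasing_open[of 0 \<tau> "\<lambda>r. e r * exp ((1 + \<epsilon>\<^sub>1) * c * r)"])
    fix r assume r: "0 < r" "r < \<tau>"
    have "p r \<ge> 0"
      using r by (intro p_nonneg nonneg_while_error_pos[of r]) (auto intro!: before)
    then have "0 \<le> (\<epsilon>\<^sub>1 - \<epsilon>\<^sub>2) * p r * exp ((1 + \<epsilon>\<^sub>1) * c * r)" using par by simp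
    moreover have "((\<lambda>r. e r * exp ((1 + \<epsilon>\<^sub>1) * c * r)) has_real_derivative
        (\<epsilon>\<^sub>1 - \<epsilon>\<^sub>2) * p r * exp ((1 + \<epsilon>\<^sub>1) * c * r)) (at r)"
      by (auto intro!: derivative_eq_intros e_deriv r simp: algebra_simps)
    ultimately show "\<exists>y. ((\<lambda>r. e r * exp ((1 + \<epsilon>\<^sub>1) * c * r)) has_real_derivative y) (at r) \<and> 0 \<le> y"
      by blast
  next
    show "continuous_on {0..\<tau>} (\<lambda>r. e r * exp ((1 + \<epsilon>\<^sub>1) * c * r))"
      by (intro continuous_intros continuous_on_subset[OF e_cont]) auto
  qed (use \<tau> in auto)
  then show False using mult_nonpos_nonneg[OF \<tau>(2), of "exp ((1 + \<epsilon>\<^sub>1) * c * \<tau>)"] init(2) by simp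
qed

lemma v_nonneg: "t \<ge> 0 \<Longrightarrow> y \<in> {0..1} \<Longrightarrow> v y t \<ge> 0"
  by (rule nonneg_while_error_pos[of t]) (auto intro: e_pos)

lemma p_ge_0: "t > 0 \<Longrightarrow> p t \<ge> 0"
  by (rule p_nonneg) (auto intro: v_nonneg)

lemma m_nonneg:
  assumes "t \<ge> 0"
  shows "m t \<ge> 0"
proof -
  have "integral {0..1} (\<lambda>y. v y t) \<ge> 0"
    by (rule integral_nonneg)
      (use assms in \<open>auto intro!: v_nonneg integrable_continuous_interval v_comp continuous_intros\<close>)
  then show ?thesis using s_pos[OF assms] by (simp add: m_def)
qed

lemma s_less_setpoint:
  assumes "t \<ge> 0"
  shows "s t < sr"
proof -
  have "m t / \<alpha> \<ge> 0" using m_nonneg[OF assms] par by simp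
  then have "(s t - sr) / \<beta> < 0" using e_pos[OF assms] by (simp add: e_def)
  then show ?thesis using par by (simp add: divide_less_0_iff)
qed

end

section \<open>Lyapunov functions\<close>

context straightened_loop
begin

text \<open>No mixed derivative of \<open>v\<close> need exist, so \<open>N\<close> is differentiated as the diagonal of the symmetric
  form \<open>\<integral> vy(t) vy(t')\<close>, which depends on \<open>t\<close> only through \<open>v\<close> after integration by parts.\<close>

lemma N_deriv:
  assumes t: "t > 0"
  shows "(N has_real_derivative 2 * (w 0 t * (s t * c * e t)) -
    2 * (\<alpha> * (1 + \<epsilon>\<^sub>1) / (s t)\<^sup>2 * Y t + s' t / s t * (((s t * p t)\<^sup>2 - N t) / 2))) (at t)"
proof -
  define B where "B t t' = integral {0..1} (\<lambda>y. vy y t * vy y t')" for t t'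
  define D where "D t t' = - w 0 t * vy 0 t' - integral (cbox 0 1) (\<lambda>y. w y t * vyy y t')" for t t'
  have B_eq: "B t t' = - v 0 t * vy 0 t' - integral (cbox 0 1) (\<lambda>y. v y t * vyy y t')"
    if tt: "t > 0" "t' > 0" for t t'
  proof -
    have sum: "((\<lambda>y. v y t * vyy y t' + vy y t * vy y t') has_integral v 1 t * vy 1 t' - v 0 t * vy 0 t') {0..1}"
    proof (rule fundamental_theorem_of_calculus)
      fix y :: real assume y: "y \<in> {0..1}"
      from DERIV_mult'[OF v_deriv[OF tt(1) y] vy_deriv[OF tt(2) y]]
      show "((\<lambda>y. v y t * vy y t') has_vector_derivative v y t * vyy y t' + vy y t * vy y t') (at y within {0..1})"
        by (simp flip: has_real_derivative_iff_has_vector_derivative)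
    qed simp
    have "((\<lambda>y. v y t * vyy y t') has_integral integral (cbox 0 1) (\<lambda>y. v y t * vyy y t')) (cbox 0 1)"
      using tt by (intro integrable_integral integrable_continuous continuous_intros v_comp vyy_comp) auto
    from has_integral_diff[OF sum this[unfolded cbox_interval]]
    have "((\<lambda>y. vy y t * vy y t') has_integral
        v 1 t * vy 1 t' - v 0 t * vy 0 t' - integral (cbox 0 1) (\<lambda>y. v y t * vyy y t')) {0..1}"
      by simp
    then show ?thesis using tt unfolding B_def by (simp add: integral_unique v_one)
  qed
  have B_deriv: "((\<lambda>t. B t t') has_real_derivative D t t') (at t)" if tt: "t \<in> {0<..}" "t' \<in> {0<..}" for t t'
  proof -
    have "((\<lambda>t. integral (cbox 0 1) (\<lambda>y. v y t * vyy y t')) has_real_derivative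
        integral (cbox 0 1) (\<lambda>y. w y t * vyy y t')) (at t within {0<..})"
    proof (rule leibniz_rule_field_derivative)
      show "((\<lambda>t. v y t * vyy y t') has_real_derivative w y t * vyy y t') (at t within {0<..})"
        if "t \<in> {0<..}" "y \<in> cbox 0 1" for t y
        by (rule has_field_derivative_at_within[OF DERIV_cmult_right[OF v_time_deriv]]) (use that in auto)
      show "(\<lambda>y. v y t * vyy y t') integrable_on cbox 0 1" if "t \<in> {0<..}" for t
        using that tt by (intro integrable_continuous continuous_intros v_comp vyy_comp) auto
      have "continuous_on ({0<..} \<times> cbox 0 1) (\<lambda>z. w (snd z) (fst z) * vyy (snd z) t')"
        using tt by (intro continuous_intros w_comp vyy_comp) auto
      then show "continuous_on ({0<..} \<times> cbox 0 1) (\<lambda>(t, y). w y t * vyy y t')" by (simp add: case_prod_unfold)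
    qed (use tt in auto)
    then have I: "((\<lambda>t. integral (cbox 0 1) (\<lambda>y. v y t * vyy y t')) has_real_derivative
        integral (cbox 0 1) (\<lambda>y. w y t * vyy y t')) (at t)"
      using tt by (simp add: at_within_open[of t "{0<..}"])
    have "((\<lambda>t. - v 0 t * vy 0 t' - integral (cbox 0 1) (\<lambda>y. v y t * vyy y t')) has_real_derivative D t t') (at t)"
      unfolding D_def using tt
      by (intro DERIV_diff DERIV_cmult_right DERIV_minus I v_time_deriv) auto
    then show ?thesis
      by (rule has_field_derivative_transform_within_open[where S = "{0<..}"]) (use tt B_eq in auto)
  qed
  have D_cont: "continuous_on ({0<..} \<times> {0<..}) (\<lambda>(t, t'). D t t')"
  proof -
    have "continuous_on ({0<..} \<times> {0<..})
        (\<lambda>z. integral (cbox 0 1) (\<lambda>y. w y (fst z) * vyy y (snd z)))"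
    proof (rule integral_continuous_on_param)
      have "continuous_on (({0<..} \<times> {0<..}) \<times> cbox 0 1)
          (\<lambda>q. w (snd q) (fst (fst q)) * vyy (snd q) (snd (fst q)))"
        by (intro continuous_intros w_comp vyy_comp) auto
      then show "continuous_on (({0<..} \<times> {0<..}) \<times> cbox 0 1)
          (\<lambda>(z, y). w y (fst z) * vyy y (snd z))" by (simp add: case_prod_unfold)
    qed
    then have "continuous_on ({0<..} \<times> {0<..}) (\<lambda>z. D (fst z) (snd z))"
      unfolding D_def by (intro continuous_intros w_comp vy_comp) auto
    then show ?thesis by (simp add: case_prod_unfold)
  qed
  have "((\<lambda>t. B t t) has_real_derivative 2 * D t t) (at t)"
    by (rule has_real_derivative_diagonal[where U = "{0<..}"])
      (use t B_deriv D_cont in \<open>auto simp: B_def mult.commute\<close>)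
  moreover have "(\<lambda>t. B t t) = N" by (simp add: B_def N_def fun_eq_iff power2_eq_square)
  ultimately have N: "(N has_real_derivative 2 * D t t) (at t)" by simp

  have NI: "((\<lambda>y. (vy y t)\<^sup>2) has_integral N t) {0..1}"
    unfolding N_def using t
    by (intro integrable_integral integrable_continuous_interval continuous_intros vy_comp) auto
  have YI: "((\<lambda>y. (vyy y t)\<^sup>2) has_integral Y t) {0..1}"
    unfolding Y_def using t
    by (intro integrable_integral integrable_continuous_interval continuous_intros vyy_comp) auto
  \<comment> \<open>Integrating the derivative of \<open>y * (vy y t)\<^sup>2\<close> evaluates the
    transport part of \<open>\<integral> w vyy\<close> by its boundary value and
    \<open>N\<close>.\<close>
  have "((\<lambda>y. (vy y t)\<^sup>2 + 2 * (y * vy y t * vyy y t)) has_integral 1 * (vy 1 t)\<^sup>2 - 0 * (vy 0 t)\<^sup>2) {0..1}"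
  proof (rule fundamental_theorem_of_calculus)
    fix y :: real assume y: "y \<in> {0..1}"
    from DERIV_mult'[OF DERIV_ident DERIV_mult'[OF vy_deriv[OF t y] vy_deriv[OF t y]]]
    show "((\<lambda>y. y * (vy y t)\<^sup>2) has_vector_derivative (vy y t)\<^sup>2 + 2 * (y * vy y t * vyy y t)) (at y within {0..1})"
      by (simp add: power2_eq_square algebra_simps flip: has_real_derivative_iff_has_vector_derivative)
  qed simp
  from has_integral_divide[OF has_integral_diff[OF this NI], of 2]
  have b: "((\<lambda>y. y * vy y t * vyy y t) has_integral ((vy 1 t)\<^sup>2 - N t) / 2) {0..1}" by simp
  have "((\<lambda>y. \<alpha> * (1 + \<epsilon>\<^sub>1) / (s t)\<^sup>2 * (vyy y t)\<^sup>2 + s' t / s t * (y * vy y t * vyy y t)) has_integral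
      (\<alpha> * (1 + \<epsilon>\<^sub>1) / (s t)\<^sup>2 * Y t + s' t / s t * (((vy 1 t)\<^sup>2 - N t) / 2))) {0..1}"
    by (intro has_integral_add has_integral_mult_right YI b)
  moreover have "(\<lambda>y. \<alpha> * (1 + \<epsilon>\<^sub>1) / (s t)\<^sup>2 * (vyy y t)\<^sup>2 + s' t / s t * (y * vy y t * vyy y t)) =
      (\<lambda>y. w y t * vyy y t)"
    by (auto simp: w_def power2_eq_square algebra_simps)
  moreover have "(vy 1 t)\<^sup>2 = (s t * p t)\<^sup>2" using s_nz[of t] t by (simp add: p_def)
  ultimately have W: "integral (cbox 0 1) (\<lambda>y. w y t * vyy y t) =
      \<alpha> * (1 + \<epsilon>\<^sub>1) / (s t)\<^sup>2 * Y t + s' t / s t * (((s t * p t)\<^sup>2 - N t) / 2)"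
    by (simp add: integral_unique)
  have "2 * D t t = 2 * (w 0 t * (s t * c * e t)) -
    2 * (\<alpha> * (1 + \<epsilon>\<^sub>1) / (s t)\<^sup>2 * Y t + s' t / s t * (((s t * p t)\<^sup>2 - N t) / 2))"
    unfolding D_def W flux[OF t] by (simp add: algebra_simps)
  with N show ?thesis by simp
qed

definition W :: "real \<Rightarrow> real" where "W t = N t / s t - 2 * c * e t * v 0 t"

text \<open>Two cancellations occur: the terms with \<open>e t * w 0 t\<close> drop out by the
  choice of the correction, and the derivative of the factor \<open>1 / s t\<close> removes the term
  with \<open>s' t * N t\<close>. Of the transport part only \<open>- s' t * (p t)\<^sup>2\<close>
  is left.\<close>

lemma W_deriv:
  assumes t: "t > 0"
  shows "(W has_real_derivative - s' t * (p t)\<^sup>2 - 2 * \<alpha> * (1 + \<epsilon>\<^sub>1) * Y t / (s t)^3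
    + 2 * c\<^sup>2 * (1 + \<epsilon>\<^sub>1) * (e t * v 0 t) - 2 * c * (\<epsilon>\<^sub>1 - \<epsilon>\<^sub>2) * (p t * v 0 t)) (at t)"
proof -
  define n where "n = 2 * (w 0 t * (s t * c * e t)) -
    2 * (\<alpha> * (1 + \<epsilon>\<^sub>1) / (s t)\<^sup>2 * Y t + s' t / s t * (((s t * p t)\<^sup>2 - N t) / 2))"
  define f where "f = - (1 + \<epsilon>\<^sub>1) * c * e t + (\<epsilon>\<^sub>1 - \<epsilon>\<^sub>2) * p t"
  have s: "s t \<noteq> 0" using s_nz[of t] t by simp
  have "((\<lambda>t. N t / s t - (2 * c) * (e t * v 0 t)) has_real_derivative
      (n * s t - N t * s' t) / (s t * s t) - (2 * c) * (e t * w 0 t + f * v 0 t)) (at t)"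
    unfolding n_def f_def
    by (intro DERIV_diff DERIV_divide DERIV_cmult DERIV_mult' N_deriv e_deriv s_deriv v_time_deriv t s) auto
  moreover have "(\<lambda>t. N t / s t - (2 * c) * (e t * v 0 t)) = W"
    by (simp add: W_def fun_eq_iff mult.assoc)
  moreover have "(n * s t - N t * s' t) / (s t * s t) =
     2 * c * (e t * w 0 t) - 2 * \<alpha> * (1 + \<epsilon>\<^sub>1) * Y t / (s t)^3 - s' t * (p t)\<^sup>2"
    unfolding n_def using s by (simp add: divide_simps power2_eq_square power3_eq_cube) (simp add: algebra_simps)
  ultimately show ?thesis
    by (simp add: f_def algebra_simps power2_eq_square)
qed

section \<open>Energy inequalities in fixed coordinates\<close>

lemma N_nonneg: "t > 0 \<Longrightarrow> N t \<ge> 0"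
  unfolding N_def by (rule integral_nonneg)
    (auto intro!: integrable_continuous_interval continuous_intros vy_comp)

lemma Y_nonneg: "t > 0 \<Longrightarrow> Y t \<ge> 0"
  unfolding Y_def by (rule integral_nonneg)
    (auto intro!: integrable_continuous_interval continuous_intros vyy_comp)

text \<open>A Poincare-type bound anchored at the interface, where \<open>v\<close>
  vanishes.\<close>

lemma v_square_le_N:
  assumes "t > 0" "y \<in> {0..1}"
  shows "(v y t)\<^sup>2 \<le> N t"
proof -
  have "continuous_on {0..1} (\<lambda>y. vy y t)"
    using assms by (intro vy_comp continuous_intros) auto
  from square_diff_le_integral_square_deriv[OF v_deriv[OF assms(1)] this _ assms(2), of 1]
  show ?thesis using assms by (simp add: N_def v_one)
qed

lemma integral_v_square_le_N:
  assumes t: "t > 0"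
  shows "integral {0..1} (\<lambda>y. (v y t)\<^sup>2) \<le> N t"
proof -
  have "integral {0..1} (\<lambda>y. (v y t)\<^sup>2) \<le> integral {0..1::real} (\<lambda>y. N t)"
    by (rule integral_le)
      (use t in \<open>auto intro!: v_square_le_N integrable_continuous_interval continuous_intros v_comp\<close>)
  then show ?thesis by simp
qed

lemma m_square_le:
  assumes t: "t > 0"
  shows "(m t)\<^sup>2 \<le> (s t)\<^sup>2 * N t"
proof -
  have "norm (integral (cbox 0 1) (\<lambda>y. v y t)) \<le> sqrt (N t) * measure lborel (cbox 0 (1::real))"
  proof (rule integrable_bound)
    show "(\<lambda>y. v y t) integrable_on cbox 0 1"
      using t by (intro integrable_continuous v_comp continuous_intros) auto
    show "norm (v y t) \<le> sqrt (N t)" if "y \<in> cbox 0 1" for y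
      using v_square_le_N[of t y] t that real_le_rsqrt[of "\<bar>v y t\<bar>" "N t"] by simp
  qed (use N_nonneg[OF t] in simp)
  then have "\<bar>integral {0..1} (\<lambda>y. v y t)\<bar>\<^sup>2 \<le> (sqrt (N t))\<^sup>2"
    by (intro power_mono) auto
  then show ?thesis
    using N_nonneg[OF t] by (simp add: m_def power_mult_distrib mult_left_mono)
qed

text \<open>The same bound for \<open>vy\<close>, anchored at the heated end, where the flux
  condition expresses \<open>vy 0 t\<close> through \<open>e t\<close>. It lets the dissipation
  \<open>Y\<close> control \<open>N\<close> up to a multiple of \<open>e\<^sup>2\<close>.\<close>

lemma N_le:
  assumes t: "t > 0"
  shows "N t \<le> 2 * (s t * c * e t)\<^sup>2 + 2 * Y t"
proof -
  have "(vy y t)\<^sup>2 \<le> 2 * (s t * c * e t)\<^sup>2 + 2 * Y t" if y: "y \<in> {0..1}" for y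
  proof -
    have "(vy y t - vy 0 t)\<^sup>2 \<le> Y t"
      unfolding Y_def using t y
      by (intro square_diff_le_integral_square_deriv[OF vy_deriv]) (auto intro!: vyy_comp continuous_intros)
    moreover have "(vy y t)\<^sup>2 \<le> 2 * (vy 0 t)\<^sup>2 + 2 * (vy y t - vy 0 t)\<^sup>2"
      using zero_le_power2[of "vy y t - 2 * vy 0 t"] by (simp add: power2_eq_square algebra_simps)
    moreover have "(vy 0 t)\<^sup>2 = (s t * c * e t)\<^sup>2" by (simp add: flux[OF t])
    ultimately show ?thesis by linarith
  qed
  then have "integral {0..1} (\<lambda>y. (vy y t)\<^sup>2) \<le> integral {0..1::real} (\<lambda>y. 2 * (s t * c * e t)\<^sup>2 + 2 * Y t)"
    by (intro integral_le) (use t in \<open>auto intro!: integrable_continuous_interval continuous_intros vy_comp\<close>)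
  then show ?thesis by (simp add: N_def)
qed

end

section \<open>Abstract exponential decay from two dissipation inequalities\<close>

definition lyapunov_system ::
  "real \<Rightarrow> real \<Rightarrow> real \<Rightarrow> real \<Rightarrow> real \<Rightarrow> (real \<Rightarrow> real) \<Rightarrow> (real \<Rightarrow> real) \<Rightarrow>
   (real \<Rightarrow> real) \<Rightarrow> (real \<Rightarrow> real) \<Rightarrow> (real \<Rightarrow> real) \<Rightarrow> (real \<Rightarrow> real) \<Rightarrow> bool" where
  "lyapunov_system k1 k2 k3 C1 C2 R e V V' W W' \<longleftrightarrow>
    (\<forall>t>0. 0 \<le> R t \<and> (V has_real_derivative V' t) (at t) \<and> (W has_real_derivative W' t) (at t) \<and>
       2 * V t * V' t \<le> - k3 * (e t)\<^sup>2 \<and> W' t \<le> - k1 * R t + k2 * (e t)\<^sup>2 \<and>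
       (e t)\<^sup>2 \<le> (V t)\<^sup>2 \<and> (V t)\<^sup>2 \<le> C1 * (R t + (e t)\<^sup>2) \<and>
       R t / 2 - C2 * (e t)\<^sup>2 \<le> W t \<and> W t \<le> C2 * (R t + (e t)\<^sup>2))"

text \<open>\<open>V\<close> dissipates only \<open>e\<^sup>2\<close>, and \<open>W\<close>
  dissipates \<open>R\<close> at the price of \<open>k2 * e\<^sup>2\<close>; the combination
  \<open>B * V\<^sup>2 + W\<close> dissipates both and is equivalent to
  \<open>R + e\<^sup>2\<close>. The hypotheses are bundled in one predicate so that \<open>D\<close>
  and \<open>b\<close> are fixed before the functions are given.\<close>

lemma lyapunov_decay:
  fixes k1 k2 k3 C1 C2 :: real
  assumes k: "k1 > 0" "k2 > 0" "k3 > 0" "C1 > 0" "C2 > 0"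
  shows "\<exists>D>0. \<exists>b>0. \<forall>R e V V' W W' :: real \<Rightarrow> real.
    lyapunov_system k1 k2 k3 C1 C2 R e V V' W W' \<longrightarrow>
    (\<forall>t0 t. 0 < t0 \<and> t0 \<le> t \<longrightarrow> R t + (e t)\<^sup>2 \<le> D * (R t0 + (e t0)\<^sup>2) * exp (- b * (t - t0)))"
proof -
  \<comment> \<open>The summand \<open>(k2 + 1) / k3\<close> absorbs \<open>k2 * e\<^sup>2\<close>
    and leaves one \<open>e\<^sup>2\<close> of dissipation; \<open>C2 + 1\<close> outweighs the
    negative part of \<open>W\<close>, again with one \<open>e\<^sup>2\<close> to spare.\<close>
  define B where "B = (k2 + 1) / k3 + C2 + 1"
  define K where "K = B * C1 + C2"
  \<comment> \<open>The functional loses at least \<open>min 1 k1 * (R + e\<^sup>2)\<close> and is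
    at most \<open>K * (R + e\<^sup>2)\<close>; the quotient is the decay rate.\<close>
  define b where "b = min 1 k1 / K"
  have B: "B > 0" "B \<ge> C2 + 1" "B * k3 \<ge> k2 + 1"
    using k by (auto simp: B_def field_simps add_pos_pos)
  have K: "K > 0" using B k by (simp add: K_def add_pos_pos)
  have b: "b > 0" using K k by (simp add: b_def)
  have "R t + (e t)\<^sup>2 \<le> 2 * K * (R t0 + (e t0)\<^sup>2) * exp (- b * (t - t0))"
    if H: "\<And>t. t > 0 \<Longrightarrow> 0 \<le> R t \<and> (V has_real_derivative V' t) (at t) \<and> (W has_real_derivative W' t) (at t) \<and>
       2 * V t * V' t \<le> - k3 * (e t)\<^sup>2 \<and> W' t \<le> - k1 * R t + k2 * (e t)\<^sup>2 \<and>
       (e t)\<^sup>2 \<le> (V t)\<^sup>2 \<and> (V t)\<^sup>2 \<le> C1 * (R t + (e t)\<^sup>2) \<and>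
       R t / 2 - C2 * (e t)\<^sup>2 \<le> W t \<and> W t \<le> C2 * (R t + (e t)\<^sup>2)"
    and t: "0 < t0" "t0 \<le> t" for R e V V' W W' :: "real \<Rightarrow> real" and t0 t
  proof -
    define L where "L t = B * (V t)\<^sup>2 + W t" for t
    define q where "q t = R t + (e t)\<^sup>2" for t
    have lower: "q t \<le> 2 * L t" if "t > 0" for t
    proof -
      have "R t / 2 - C2 * (e t)\<^sup>2 \<le> W t" using H[OF that] by blast
      moreover
      have "B * (V t)\<^sup>2 \<ge> B * (e t)\<^sup>2" using H[OF that] B by (intro mult_left_mono) auto
      moreover have "B * (e t)\<^sup>2 \<ge> (C2 + 1) * (e t)\<^sup>2" using B by (intro mult_right_mono) auto
      moreover have "(C2 + 1) * (e t)\<^sup>2 = C2 * (e t)\<^sup>2 + (e t)\<^sup>2" by (simp add: algebra_simps)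
      moreover have "(e t)\<^sup>2 \<ge> 0" by simp
      ultimately show ?thesis unfolding L_def q_def distrib_left by linarith
    qed
    have upper: "L t \<le> K * q t" if "t > 0" for t
    proof -
      have "B * (V t)\<^sup>2 \<le> B * (C1 * q t)" using H[OF that] B unfolding q_def by (intro mult_left_mono) auto
      then show ?thesis using H[OF that] unfolding L_def q_def K_def by (simp add: algebra_simps)
    qed
    have "L t * exp (b * t) \<le> L t0 * exp (b * t0)"
    proof (rule DERIV_nonpos_imp_nonincreasing[OF t(2)])
      fix r assume "t0 \<le> r"
      then have r: "r > 0" using t by simp
      note Hr = H[OF r]
      have "((\<lambda>r. L r * exp (b * r)) has_real_derivative
          (B * (2 * V r * V' r) + W' r + b * L r) * exp (b * r)) (at r)"
        unfolding L_def using Hr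
        by (auto intro!: derivative_eq_intros simp: algebra_simps)
      moreover have "B * (2 * V r * V' r) + W' r + b * L r \<le> 0"
      proof -
        have "B * (2 * V r * V' r) \<le> B * (- k3 * (e r)\<^sup>2)" using Hr B by (intro mult_left_mono) auto
        also have "\<dots> = - (B * k3 * (e r)\<^sup>2)" by simp
        also have "\<dots> \<le> - ((k2 + 1) * (e r)\<^sup>2)" using B by (simp add: mult_right_mono)
        also have "\<dots> = - (k2 * (e r)\<^sup>2) - (e r)\<^sup>2" by (simp add: algebra_simps)
        finally have "B * (2 * V r * V' r) + W' r \<le> - (k1 * R r) - (e r)\<^sup>2" using Hr by simp
        moreover have "min 1 k1 * R r \<le> k1 * R r" using Hr by (intro mult_right_mono) auto
        moreover have "min 1 k1 * (e r)\<^sup>2 \<le> 1 * (e r)\<^sup>2" by (intro mult_right_mono) auto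
        moreover have "b * L r \<le> min 1 k1 * R r + min 1 k1 * (e r)\<^sup>2"
        proof -
          have "b * L r \<le> b * (K * q r)" using upper[OF r] b by (intro mult_left_mono) auto
          also have "\<dots> = min 1 k1 * R r + min 1 k1 * (e r)\<^sup>2"
            using K unfolding b_def q_def by (simp add: algebra_simps)
          finally show ?thesis .
        qed
        ultimately show ?thesis by linarith
      qed
      then have "(B * (2 * V r * V' r) + W' r + b * L r) * exp (b * r) \<le> 0"
        by (simp add: mult_nonpos_nonneg)
      ultimately show "\<exists>y. ((\<lambda>r. L r * exp (b * r)) has_real_derivative y) (at r) \<and> y \<le> 0"
        by blast
    qed
    then have "L t * exp (b * t) * exp (- b * t) \<le> L t0 * exp (b * t0) * exp (- b * t)"
      by (intro mult_right_mono) auto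
    then have "L t \<le> L t0 * exp (- b * (t - t0))"
      by (simp add: mult.assoc algebra_simps flip: exp_add)
    also have "\<dots> \<le> K * q t0 * exp (- b * (t - t0))"
      using upper[of t0] t by (intro mult_right_mono) auto
    finally show ?thesis using lower[of t] t unfolding q_def by simp
  qed
  moreover have "2 * K > 0" using K by simp
  ultimately show ?thesis using b unfolding lyapunov_system_def by blast
qed

lemma square_sum_le: "(x + y)\<^sup>2 \<le> 2 * x\<^sup>2 + 2 * (y::real)\<^sup>2"
  using zero_le_power2[of "x - y"] by (simp add: power2_eq_square algebra_simps)

lemma young_le:
  fixes x y \<eta> :: real
  assumes "\<eta> > 0"
  shows "2 * (x * y) \<le> \<eta> * y\<^sup>2 + x\<^sup>2 / \<eta>"
proof -
  have "0 \<le> (\<eta> * y - x)\<^sup>2 / \<eta>" using assms by simp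
  also have "\<dots> = \<eta> * y\<^sup>2 + x\<^sup>2 / \<eta> - 2 * (x * y)"
    using assms by (simp add: power2_eq_square field_simps)
  finally show ?thesis by simp
qed

section \<open>Estimates with constants that involve only the parameters and the setpoint\<close>

context straightened_loop
begin

text \<open>The squared \<open>L\<^sub>2\<close> norm of \<open>T\<^sub>x\<close> on the moving
  domain: \<open>vy\<close> carries a factor \<open>s t\<close>, and the change of variables
  contributes another.\<close>

definition R :: "real \<Rightarrow> real" where "R t = N t / s t"

lemma setpoint_pos: "sr > 0"
  using s_less_setpoint[of 0] s_pos[of 0] by simp

lemma R_nonneg: "t > 0 \<Longrightarrow> R t \<ge> 0"
  using N_nonneg s_pos[of t] by (simp add: R_def)

lemma N_eq: "t > 0 \<Longrightarrow> N t = s t * R t"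
  using s_nz[of t] by (simp add: R_def)

lemma N_le_R:
  assumes "t > 0"
  shows "N t \<le> sr * R t"
  using N_eq[OF assms] s_less_setpoint[of t] R_nonneg[OF assms] assms by (simp add: mult_right_mono)

lemma v0_square_le: "t > 0 \<Longrightarrow> (v 0 t)\<^sup>2 \<le> sr * R t"
  using v_square_le_N[of t 0] N_le_R[of t] by simp

lemma m_square_le_R:
  assumes t: "t > 0"
  shows "(m t)\<^sup>2 \<le> sr ^ 3 * R t"
proof -
  have "(m t)\<^sup>2 \<le> (s t)\<^sup>2 * N t" by (rule m_square_le[OF t])
  also have "\<dots> \<le> sr\<^sup>2 * (sr * R t)"
    using s_pos[of t] s_less_setpoint[of t] N_le_R N_nonneg t by (intro mult_mono power_mono) auto
  finally show ?thesis by (simp add: power2_eq_square power3_eq_cube mult.assoc)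
qed

text \<open>The terms with \<open>s' t\<close> and with \<open>p t * v 0 t\<close> have the
  favourable sign and are dropped. By \<open>N_le\<close> the diffusion term supplies
  \<open>a / sr\<^sup>2 * R t\<close> up to a multiple of \<open>e\<^sup>2\<close>, and half of this
  pays for the term with \<open>e t * v 0 t\<close>.\<close>

lemma W_deriv_le:
  assumes t: "t > 0"
  defines "a \<equiv> \<alpha> * (1 + \<epsilon>\<^sub>1)"
  shows "- s' t * (p t)\<^sup>2 - 2 * \<alpha> * (1 + \<epsilon>\<^sub>1) * Y t / (s t)^3
      + 2 * c\<^sup>2 * (1 + \<epsilon>\<^sub>1) * (e t * v 0 t) - 2 * c * (\<epsilon>\<^sub>1 - \<epsilon>\<^sub>2) * (p t * v 0 t)
    \<le> - (a / (2 * sr\<^sup>2)) * R t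
      + (2 * a * c\<^sup>2 / sr + 2 * c ^ 4 * (1 + \<epsilon>\<^sub>1)\<^sup>2 * sr ^ 3 / a) * (e t)\<^sup>2"
proof -
  have a: "a > 0" using par by (simp add: a_def)
  note s = s_pos[of t] s_less_setpoint[of t] and sr = setpoint_pos
  have "s' t \<ge> 0" using p_ge_0[OF t] par by (simp add: s'_def)
  then have 1: "s' t * (p t)\<^sup>2 \<ge> 0" by simp
  have 2: "2 * c * (\<epsilon>\<^sub>1 - \<epsilon>\<^sub>2) * (p t * v 0 t) \<ge> 0"
    using par p_ge_0[OF t] v_nonneg[of t 0] t by simp
  have "s t * R t \<le> s t * (2 * sr * c\<^sup>2 * (e t)\<^sup>2 + 2 * (Y t / s t))"
  proof -
    have "s t * R t \<le> 2 * (s t * c * e t)\<^sup>2 + 2 * Y t" using N_le[OF t] N_eq[OF t] by simp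
    also have "2 * (s t * c * e t)\<^sup>2 = s t * (2 * s t * c\<^sup>2 * (e t)\<^sup>2)" by (simp add: power2_eq_square)
    also have "\<dots> \<le> s t * (2 * sr * c\<^sup>2 * (e t)\<^sup>2)"
      using s t by (intro mult_left_mono mult_right_mono) auto
    finally show ?thesis using s t by (simp add: algebra_simps)
  qed
  then have RY: "R t - 2 * sr * c\<^sup>2 * (e t)\<^sup>2 \<le> 2 * (Y t / s t)" using s t by simp
  have "a / sr\<^sup>2 * (R t - 2 * sr * c\<^sup>2 * (e t)\<^sup>2) \<le> a / sr\<^sup>2 * (2 * (Y t / s t))"
    using a RY by (intro mult_left_mono) auto
  also have "\<dots> \<le> a / (s t)\<^sup>2 * (2 * (Y t / s t))"
    using a s t Y_nonneg[OF t] by (intro mult_right_mono divide_left_mono power_mono) auto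
  also have "\<dots> = 2 * \<alpha> * (1 + \<epsilon>\<^sub>1) * Y t / (s t)^3"
    by (simp add: a_def power2_eq_square power3_eq_cube mult.assoc)
  finally have 3: "a / sr\<^sup>2 * (R t - 2 * sr * c\<^sup>2 * (e t)\<^sup>2) \<le> 2 * \<alpha> * (1 + \<epsilon>\<^sub>1) * Y t / (s t)^3" .
  have 30: "a / sr\<^sup>2 * (R t - 2 * sr * c\<^sup>2 * (e t)\<^sup>2) = 2 * (a / (2 * sr\<^sup>2)) * R t - 2 * a * c\<^sup>2 / sr * (e t)\<^sup>2"
    using sr by (simp add: field_simps power2_eq_square)
  \<comment> \<open>With \<open>(v 0 t)\<^sup>2 \<le> sr * R t\<close>, this weight in Young's
    inequality costs exactly half of the coefficient \<open>a / sr\<^sup>2\<close>.\<close>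
  define \<eta> where "\<eta> = a / (2 * sr ^ 3)"
  have \<eta>: "\<eta> > 0" using a sr by (simp add: \<eta>_def)
  have "2 * c\<^sup>2 * (1 + \<epsilon>\<^sub>1) * (e t * v 0 t) = 2 * ((c\<^sup>2 * (1 + \<epsilon>\<^sub>1) * e t) * v 0 t)" by simp
  also have "\<dots> \<le> \<eta> * (v 0 t)\<^sup>2 + (c\<^sup>2 * (1 + \<epsilon>\<^sub>1) * e t)\<^sup>2 / \<eta>" by (rule young_le[OF \<eta>])
  also have "\<dots> \<le> \<eta> * (sr * R t) + (c\<^sup>2 * (1 + \<epsilon>\<^sub>1) * e t)\<^sup>2 / \<eta>"
    using \<eta> v0_square_le[OF t] by (intro add_right_mono mult_left_mono) auto
  also have "\<eta> * (sr * R t) = a / (2 * sr\<^sup>2) * R t"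
    using sr by (simp add: \<eta>_def power2_eq_square power3_eq_cube)
  also have "(c\<^sup>2 * (1 + \<epsilon>\<^sub>1) * e t)\<^sup>2 / \<eta> = 2 * c ^ 4 * (1 + \<epsilon>\<^sub>1)\<^sup>2 * sr ^ 3 / a * (e t)\<^sup>2"
    by (simp add: \<eta>_def power_mult_distrib)
  finally have 4: "2 * c\<^sup>2 * (1 + \<epsilon>\<^sub>1) * (e t * v 0 t) \<le>
      a / (2 * sr\<^sup>2) * R t + 2 * c ^ 4 * (1 + \<epsilon>\<^sub>1)\<^sup>2 * sr ^ 3 / a * (e t)\<^sup>2" .
  show ?thesis using 1 2 3 4 unfolding 30 distrib_right by linarith
qed

lemma W_bounds:
  assumes t: "t > 0"
  shows "R t / 2 - (2 + 2 * sr * c\<^sup>2) * (e t)\<^sup>2 \<le> W t"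
    and "W t \<le> (2 + 2 * sr * c\<^sup>2) * (R t + (e t)\<^sup>2)"
proof -
  note sr = setpoint_pos
  have R: "0 \<le> R t" "0 \<le> sr * c\<^sup>2 * R t" using R_nonneg[OF t] sr by auto
  \<comment> \<open>The weight \<open>1 / (2 * sr)\<close> turns the bound on
    \<open>(v 0 t)\<^sup>2\<close> into \<open>R t / 2\<close>, so that half of \<open>R t\<close>
    remains below \<open>W t\<close>.\<close>
  have "2 * (\<bar>c * e t\<bar> * \<bar>v 0 t\<bar>) \<le> 1 / (2 * sr) * \<bar>v 0 t\<bar>\<^sup>2 + \<bar>c * e t\<bar>\<^sup>2 / (1 / (2 * sr))"
    using sr by (intro young_le) simp
  also have "1 / (2 * sr) * \<bar>v 0 t\<bar>\<^sup>2 \<le> 1 / (2 * sr) * (sr * R t)"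
    using sr v0_square_le[OF t] by (intro mult_left_mono) auto
  also have "\<dots> = R t / 2" using sr by simp
  also have "\<bar>c * e t\<bar>\<^sup>2 / (1 / (2 * sr)) = 2 * sr * c\<^sup>2 * (e t)\<^sup>2"
    by (simp add: power_mult_distrib)
  finally have "\<bar>2 * c * e t * v 0 t\<bar> \<le> R t / 2 + 2 * sr * c\<^sup>2 * (e t)\<^sup>2"
    by (simp add: abs_mult mult.assoc)
  then have "\<bar>W t - R t\<bar> \<le> R t / 2 + 2 * sr * c\<^sup>2 * (e t)\<^sup>2" by (simp add: W_def R_def)
  then show "R t / 2 - (2 + 2 * sr * c\<^sup>2) * (e t)\<^sup>2 \<le> W t"
    "W t \<le> (2 + 2 * sr * c\<^sup>2) * (R t + (e t)\<^sup>2)"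
    using R zero_le_power2[of "e t"] unfolding distrib_left distrib_right by linarith+
qed

text \<open>The weight of \<open>e\<close> in \<open>V\<close> is chosen such that the gain \<open>(\<epsilon>\<^sub>1 - \<epsilon>\<^sub>2) p\<close> in the derivative of \<open>e\<close> is
  absorbed by the loss of heat content: \<open>V'\<close> is a negative multiple of \<open>c e + p\<close>.\<close>

definition V :: "real \<Rightarrow> real" where
  "V t = m t / \<alpha> + 2 * (1 + \<epsilon>\<^sub>1) / (1 + 2 * \<epsilon>\<^sub>1 - \<epsilon>\<^sub>2) * e t"

definition V' :: "real \<Rightarrow> real" where
  "V' t = - ((1 + \<epsilon>\<^sub>1) * (1 + \<epsilon>\<^sub>2) / (1 + 2 * \<epsilon>\<^sub>1 - \<epsilon>\<^sub>2) * (c * e t + p t))"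

text \<open>With \<open>A\<close> for the weight of \<open>e\<close>, the coefficients of
  \<open>c * e t\<close> and \<open>p t\<close> in the derivative are
  \<open>(1 + \<epsilon>\<^sub>1) * (1 - A)\<close> and \<open>A * (\<epsilon>\<^sub>1 -
  \<epsilon>\<^sub>2) - (1 + \<epsilon>\<^sub>1)\<close>. The chosen \<open>A\<close> makes them
  equal.\<close>

lemma V_deriv:
  assumes t: "t > 0"
  shows "(V has_real_derivative V' t) (at t)"
proof -
  have q: "1 + 2 * \<epsilon>\<^sub>1 - \<epsilon>\<^sub>2 \<noteq> 0" using par by simp
  have "((\<lambda>t. m t / \<alpha> + 2 * (1 + \<epsilon>\<^sub>1) / (1 + 2 * \<epsilon>\<^sub>1 - \<epsilon>\<^sub>2) * e t) has_real_derivative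
    \<alpha> * (1 + \<epsilon>\<^sub>1) * (c * e t - p t) / \<alpha> + 2 * (1 + \<epsilon>\<^sub>1) / (1 + 2 * \<epsilon>\<^sub>1 - \<epsilon>\<^sub>2) *
      (- (1 + \<epsilon>\<^sub>1) * c * e t + (\<epsilon>\<^sub>1 - \<epsilon>\<^sub>2) * p t)) (at t)"
    by (intro DERIV_add DERIV_cdivide DERIV_cmult m_deriv e_deriv t)
  moreover have "\<alpha> * (1 + \<epsilon>\<^sub>1) * (c * e t - p t) / \<alpha> + 2 * (1 + \<epsilon>\<^sub>1) / (1 + 2 * \<epsilon>\<^sub>1 - \<epsilon>\<^sub>2) *
      (- (1 + \<epsilon>\<^sub>1) * c * e t + (\<epsilon>\<^sub>1 - \<epsilon>\<^sub>2) * p t) = V' t"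
    using par q unfolding V'_def by (simp add: divide_simps) (simp add: algebra_simps)
  moreover have "V = (\<lambda>t. m t / \<alpha> + 2 * (1 + \<epsilon>\<^sub>1) / (1 + 2 * \<epsilon>\<^sub>1 - \<epsilon>\<^sub>2) * e t)"
    by (simp add: V_def fun_eq_iff)
  ultimately show ?thesis by simp
qed

lemma V_ge_e:
  assumes t: "t > 0"
  shows "e t \<le> V t"
proof -
  have "1 \<le> 2 * (1 + \<epsilon>\<^sub>1) / (1 + 2 * \<epsilon>\<^sub>1 - \<epsilon>\<^sub>2)" using par by (simp add: field_simps)
  then have "1 * e t \<le> 2 * (1 + \<epsilon>\<^sub>1) / (1 + 2 * \<epsilon>\<^sub>1 - \<epsilon>\<^sub>2) * e t"
    using e_pos[of t] t by (intro mult_right_mono) auto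
  moreover have "m t / \<alpha> \<ge> 0" using m_nonneg[of t] t par by simp
  ultimately show ?thesis by (simp add: V_def)
qed

lemma V_square_bounds:
  assumes t: "t > 0"
  shows "(e t)\<^sup>2 \<le> (V t)\<^sup>2" and "(V t)\<^sup>2 \<le> (2 * sr ^ 3 / \<alpha>\<^sup>2 + 8) * (R t + (e t)\<^sup>2)"
proof -
  show "(e t)\<^sup>2 \<le> (V t)\<^sup>2" using V_ge_e[OF t] e_pos[of t] t by (intro power_mono) auto
  define A where "A = 2 * (1 + \<epsilon>\<^sub>1) / (1 + 2 * \<epsilon>\<^sub>1 - \<epsilon>\<^sub>2)"
  \<comment> \<open>The upper bound rests on \<open>1 + 2 * \<epsilon>\<^sub>1 - \<epsilon>\<^sub>2
    \<ge> 1 + \<epsilon>\<^sub>1\<close>, that is, on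
    \<open>\<epsilon>\<^sub>2 \<le> \<epsilon>\<^sub>1\<close>.\<close>
  have A: "0 \<le> A" "A \<le> 2" using par by (simp_all add: A_def field_simps)
  have "(V t)\<^sup>2 \<le> 2 * (m t / \<alpha>)\<^sup>2 + 2 * (A * e t)\<^sup>2"
    unfolding V_def A_def by (rule square_sum_le)
  also have "2 * (m t / \<alpha>)\<^sup>2 \<le> 2 * (sr ^ 3 * R t / \<alpha>\<^sup>2)"
    using m_square_le_R[OF t] by (simp add: power_divide divide_right_mono)
  also have "(A * e t)\<^sup>2 \<le> 2\<^sup>2 * (e t)\<^sup>2"
    unfolding power_mult_distrib using A by (intro mult_right_mono power_mono) auto
  finally have "(V t)\<^sup>2 \<le> 2 * sr ^ 3 / \<alpha>\<^sup>2 * R t + 8 * (e t)\<^sup>2" by simp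
  moreover have "0 \<le> 2 * sr ^ 3 / \<alpha>\<^sup>2 * (e t)\<^sup>2" "0 \<le> 8 * R t"
    using setpoint_pos R_nonneg[OF t] by auto
  ultimately show "(V t)\<^sup>2 \<le> (2 * sr ^ 3 / \<alpha>\<^sup>2 + 8) * (R t + (e t)\<^sup>2)"
    unfolding distrib_left distrib_right by linarith
qed

text \<open>Positivity makes the product monotone: \<open>V \<ge> e > 0\<close> and
  \<open>c * e + p \<ge> c * e > 0\<close> give
  \<open>V * (c * e + p) \<ge> c * e\<^sup>2\<close>.\<close>

lemma V_dissipation:
  assumes t: "t > 0"
  shows "2 * V t * V' t \<le> - (2 * ((1 + \<epsilon>\<^sub>1) * (1 + \<epsilon>\<^sub>2) / (1 + 2 * \<epsilon>\<^sub>1 - \<epsilon>\<^sub>2) * c)) * (e t)\<^sup>2"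
proof -
  define \<kappa> where "\<kappa> = (1 + \<epsilon>\<^sub>1) * (1 + \<epsilon>\<^sub>2) / (1 + 2 * \<epsilon>\<^sub>1 - \<epsilon>\<^sub>2)"
  have \<kappa>: "\<kappa> > 0" using par by (simp add: \<kappa>_def)
  have e: "e t > 0" using e_pos t by simp
  have "e t * (c * e t) \<le> V t * (c * e t + p t)"
    using V_ge_e[OF t] e par p_ge_0[OF t] by (intro mult_mono) auto
  then have "2 * \<kappa> * (e t * (c * e t)) \<le> 2 * \<kappa> * (V t * (c * e t + p t))"
    using \<kappa> by (intro mult_left_mono) auto
  then show ?thesis
    unfolding V'_def \<kappa>_def[symmetric] by (simp add: power2_eq_square algebra_simps)
qed

text \<open>The stability norm written in the fixed coordinate.\<close>

definition \<Phi> :: "real \<Rightarrow> real" where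
  "\<Phi> t = s t * integral {0..1} (\<lambda>y. (v y t)\<^sup>2) + R t + (s t - sr)\<^sup>2"

text \<open>The identity \<open>s t - sr = - \<beta> * (m t / \<alpha> + e t)\<close> trades the
  interface error for the control error, with \<open>(m t)\<^sup>2\<close> controlled by
  \<open>R t\<close>; the remaining \<open>L\<^sub>2\<close> part of the norm is controlled by
  \<open>R t\<close> through the Poincare bound.\<close>

lemma \<Phi>_bounds:
  assumes t: "t > 0"
  shows "\<Phi> t \<le> (sr\<^sup>2 + 1 + 2 * \<beta>\<^sup>2 * sr ^ 3 / \<alpha>\<^sup>2 + 2 * \<beta>\<^sup>2) * (R t + (e t)\<^sup>2)"
    and "R t + (e t)\<^sup>2 \<le> (1 + 2 * sr ^ 3 / \<alpha>\<^sup>2 + 2 / \<beta>\<^sup>2) * \<Phi> t"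
proof -
  note R = R_nonneg[OF t]
  have I: "0 \<le> integral {0..1} (\<lambda>y. (v y t)\<^sup>2)"
    by (rule integral_nonneg) (use t in \<open>auto intro!: integrable_continuous_interval continuous_intros v_comp\<close>)
  have s: "0 < s t" "s t < sr" using s_pos s_less_setpoint t by auto
  have msq: "(m t / \<alpha>)\<^sup>2 \<le> sr ^ 3 / \<alpha>\<^sup>2 * R t"
    using m_square_le_R[OF t] by (simp add: power_divide divide_right_mono)
  have "s t * integral {0..1} (\<lambda>y. (v y t)\<^sup>2) \<le> sr * (sr * R t)"
    using integral_v_square_le_N[OF t] N_le_R[OF t] s I by (intro mult_mono) auto
  moreover have "(s t - sr)\<^sup>2 \<le> 2 * \<beta>\<^sup>2 * sr ^ 3 / \<alpha>\<^sup>2 * R t + 2 * \<beta>\<^sup>2 * (e t)\<^sup>2"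
  proof -
    have "s t - sr = - \<beta> * (m t / \<alpha> + e t)" using par by (simp add: e_def)
    then have "(s t - sr)\<^sup>2 = \<beta>\<^sup>2 * (m t / \<alpha> + e t)\<^sup>2" by (simp add: power_mult_distrib)
    also have "\<dots> \<le> \<beta>\<^sup>2 * (2 * (m t / \<alpha>)\<^sup>2 + 2 * (e t)\<^sup>2)" by (intro mult_left_mono square_sum_le) auto
    also have "\<dots> \<le> \<beta>\<^sup>2 * (2 * (sr ^ 3 / \<alpha>\<^sup>2 * R t) + 2 * (e t)\<^sup>2)"
      using msq by (intro mult_left_mono) auto
    finally show ?thesis by (simp add: algebra_simps)
  qed
  ultimately have "\<Phi> t \<le> sr\<^sup>2 * R t + R t + 2 * \<beta>\<^sup>2 * sr ^ 3 / \<alpha>\<^sup>2 * R t + 2 * \<beta>\<^sup>2 * (e t)\<^sup>2"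
    by (simp add: \<Phi>_def power2_eq_square)
  moreover have "0 \<le> sr\<^sup>2 * (e t)\<^sup>2" "0 \<le> (e t)\<^sup>2" "0 \<le> 2 * \<beta>\<^sup>2 * sr ^ 3 / \<alpha>\<^sup>2 * (e t)\<^sup>2" "0 \<le> 2 * \<beta>\<^sup>2 * R t"
    using R setpoint_pos by auto
  ultimately show "\<Phi> t \<le> (sr\<^sup>2 + 1 + 2 * \<beta>\<^sup>2 * sr ^ 3 / \<alpha>\<^sup>2 + 2 * \<beta>\<^sup>2) * (R t + (e t)\<^sup>2)"
    unfolding distrib_left distrib_right mult_1_left by linarith
  have "(e t)\<^sup>2 = (m t / \<alpha> + (s t - sr) / \<beta>)\<^sup>2" by (simp only: e_def power2_minus)
  also have "\<dots> \<le> 2 * (m t / \<alpha>)\<^sup>2 + 2 * ((s t - sr) / \<beta>)\<^sup>2" by (rule square_sum_le)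
  finally have "(e t)\<^sup>2 \<le> 2 * sr ^ 3 / \<alpha>\<^sup>2 * R t + 2 / \<beta>\<^sup>2 * (s t - sr)\<^sup>2"
    using msq by (simp add: power_divide)
  moreover have "2 * sr ^ 3 / \<alpha>\<^sup>2 * R t \<le> 2 * sr ^ 3 / \<alpha>\<^sup>2 * \<Phi> t"
    using setpoint_pos s I by (intro mult_left_mono) (auto simp: \<Phi>_def)
  moreover have "2 / \<beta>\<^sup>2 * (s t - sr)\<^sup>2 \<le> 2 / \<beta>\<^sup>2 * \<Phi> t"
    using R s I by (intro mult_left_mono) (auto simp: \<Phi>_def)
  moreover have "R t \<le> \<Phi> t" using s I by (simp add: \<Phi>_def)
  ultimately show "R t + (e t)\<^sup>2 \<le> (1 + 2 * sr ^ 3 / \<alpha>\<^sup>2 + 2 / \<beta>\<^sup>2) * \<Phi> t"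
    unfolding distrib_right mult_1_left by linarith
qed

end

text \<open>All constants are fixed before the locale is interpreted, so \<open>D\<close> and
  \<open>b\<close> depend on the parameters and the setpoint but not on the solution.\<close>

lemma straightened_loop_decay:
  fixes \<alpha> \<beta> c \<epsilon>\<^sub>1 \<epsilon>\<^sub>2 sr :: real
  assumes par: "\<alpha> > 0" "\<beta> > 0" "c > 0" "\<epsilon>\<^sub>1 > -1" "\<epsilon>\<^sub>2 > -1" "\<epsilon>\<^sub>2 \<le> \<epsilon>\<^sub>1" and sr: "sr > 0"
  shows "\<exists>D>0. \<exists>b>0. \<forall>s v vy vyy. straightened_loop \<alpha> \<beta> c \<epsilon>\<^sub>1 \<epsilon>\<^sub>2 sr s v vy vyy \<longrightarrow>
    (\<forall>t0 t. 0 < t0 \<and> t0 \<le> t \<longrightarrow>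
      straightened_loop.\<Phi> sr s v vy t \<le> D * straightened_loop.\<Phi> sr s v vy t0 * exp (- b * (t - t0)))"
proof -
  define a where "a = \<alpha> * (1 + \<epsilon>\<^sub>1)"
  define k1 where "k1 = a / (2 * sr\<^sup>2)"
  define k2 where "k2 = 2 * a * c\<^sup>2 / sr + 2 * c ^ 4 * (1 + \<epsilon>\<^sub>1)\<^sup>2 * sr ^ 3 / a"
  define k3 where "k3 = 2 * ((1 + \<epsilon>\<^sub>1) * (1 + \<epsilon>\<^sub>2) / (1 + 2 * \<epsilon>\<^sub>1 - \<epsilon>\<^sub>2) * c)"
  define C1 where "C1 = 2 * sr ^ 3 / \<alpha>\<^sup>2 + 8"
  define C2 where "C2 = 2 + 2 * sr * c\<^sup>2"
  define E1 where "E1 = sr\<^sup>2 + 1 + 2 * \<beta>\<^sup>2 * sr ^ 3 / \<alpha>\<^sup>2 + 2 * \<beta>\<^sup>2"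
  define E2 where "E2 = 1 + 2 * sr ^ 3 / \<alpha>\<^sup>2 + 2 / \<beta>\<^sup>2"
  have a: "a > 0" using par by (simp add: a_def)
  have k: "k1 > 0" "k2 > 0" "k3 > 0" "C1 > 0" "C2 > 0"
    using par sr a by (auto simp: k1_def k2_def k3_def C1_def C2_def intro!: add_pos_pos)
  have E: "E1 > 0" "E2 > 0"
    using par sr by (auto simp: E1_def E2_def intro!: add_pos_pos)
  from lyapunov_decay[OF k] obtain D b where D: "D > 0" "b > 0" and
    decay: "\<And>R e V V' W W' t0 t.
    lyapunov_system k1 k2 k3 C1 C2 R e V V' W W' \<Longrightarrow>
     0 < t0 \<Longrightarrow> t0 \<le> t \<Longrightarrow> R t + (e t)\<^sup>2 \<le> D * (R t0 + (e t0)\<^sup>2) * exp (- b * (t - t0))"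
    by blast
  have "straightened_loop.\<Phi> sr s v vy t \<le>
      E1 * D * E2 * straightened_loop.\<Phi> sr s v vy t0 * exp (- b * (t - t0))"
    if "straightened_loop \<alpha> \<beta> c \<epsilon>\<^sub>1 \<epsilon>\<^sub>2 sr s v vy vyy" and t: "0 < t0" "t0 \<le> t" for s v vy vyy t0 t
  proof -
    interpret straightened_loop \<alpha> \<beta> c \<epsilon>\<^sub>1 \<epsilon>\<^sub>2 sr s v vy vyy by fact
    have "lyapunov_system k1 k2 k3 C1 C2 R e V V' W (\<lambda>t. - s' t * (p t)\<^sup>2 -
         2 * \<alpha> * (1 + \<epsilon>\<^sub>1) * Y t / (s t)^3 + 2 * c\<^sup>2 * (1 + \<epsilon>\<^sub>1) * (e t * v 0 t)
         - 2 * c * (\<epsilon>\<^sub>1 - \<epsilon>\<^sub>2) * (p t * v 0 t))"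
      unfolding lyapunov_system_def C1_def C2_def k1_def k2_def k3_def a_def
      by (intro allI impI conjI R_nonneg V_deriv W_deriv V_dissipation W_deriv_le V_square_bounds W_bounds)
    from decay[OF this t] have "E1 * (R t + (e t)\<^sup>2) \<le> E1 * (D * (R t0 + (e t0)\<^sup>2) * exp (- b * (t - t0)))"
      using E by (intro mult_left_mono) auto
    also have "\<dots> \<le> E1 * (D * (E2 * \<Phi> t0) * exp (- b * (t - t0)))"
      using \<Phi>_bounds(2)[OF t(1)] E D unfolding E2_def by (intro mult_left_mono mult_right_mono) auto
    finally show ?thesis
      using \<Phi>_bounds(1)[of t] t unfolding E1_def by (simp add: mult.assoc)
  qed
  moreover have "E1 * D * E2 > 0" using E D by simp
  ultimately show ?thesis using D(2) by blast
qed

section \<open>Closed-loop solutions in fixed coordinates\<close>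

lemma integral_rescale:
  fixes f :: "real \<Rightarrow> real"
  assumes l: "l > 0" and f: "f integrable_on {0..l}"
  shows "integral {0..l} f = l * integral {0..1} (\<lambda>y. f (y * l))"
proof -
  have "(f has_integral integral {0..l} f) (cbox 0 l)"
    using f by (simp add: integrable_integral)
  from has_integral_affinity'[OF this l, of 0]
  have "((\<lambda>y. f (y * l)) has_integral integral {0..l} f / l) {0..1}"
    using l by (simp add: mult.commute divide_inverse)
  then show ?thesis using l by (simp add: integral_unique)
qed

text \<open>In the interior the one-sided derivative is the two-sided one and equals
  \<open>deriv\<close>; the end points are negligible. The rest is the substitution
  \<open>x = y * l\<close>.\<close>

lemma H1_norm_sq_eq:
  assumes l: "l > 0" and u: "\<And>x. x \<in> {0..l} \<Longrightarrow> (u has_real_derivative u' x) (at x within {0..l})"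
    and u': "continuous_on {0..l} u'"
  shows "H1_norm_sq l u = l * integral {0..1} (\<lambda>y. (u (y * l))\<^sup>2) + integral {0..1} (\<lambda>y. (l * u' (y * l))\<^sup>2) / l"
proof -
  have uc: "continuous_on {0..l} u" by (rule DERIV_continuous_on[OF u])
  have "integral {0..l} (\<lambda>x. (u x)\<^sup>2) = l * integral {0..1} (\<lambda>y. (u (y * l))\<^sup>2)"
    by (rule integral_rescale[OF l]) (intro integrable_continuous_interval continuous_intros uc)
  moreover have "integral {0..l} (\<lambda>x. (deriv u x)\<^sup>2) = integral {0..l} (\<lambda>x. (u' x)\<^sup>2)"
  proof (rule integral_spike)
    show "negligible {0, l}" by simp
    fix x assume "x \<in> {0..l} - {0, l}"
    then have "(u has_real_derivative u' x) (at x)"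
      using u[of x] by (simp add: at_within_Icc_at)
    then show "(u' x)\<^sup>2 = (deriv u x)\<^sup>2" by (simp add: DERIV_imp_deriv)
  qed
  moreover have "integral {0..l} (\<lambda>x. (u' x)\<^sup>2) = l * integral {0..1} (\<lambda>y. (u' (y * l))\<^sup>2)"
    by (rule integral_rescale[OF l]) (intro integrable_continuous_interval continuous_intros u')
  ultimately show ?thesis
    using l unfolding H1_norm_sq_def L2_norm_sq_def power_mult_distrib
    by (simp add: power2_eq_square)
qed

lemma H1_norm_sq_nonneg: "H1_norm_sq l u \<ge> 0"
proof -
  \<comment> \<open>The integral of a nonintegrable function is 0 by convention, which settles the
    other case.\<close>
  have "integral S (\<lambda>x. (f x)\<^sup>2) \<ge> 0" for S :: "real set" and f :: "real \<Rightarrow> real"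
    by (cases "(\<lambda>x. (f x)\<^sup>2) integrable_on S") (auto simp: integral_nonneg not_integrable_integral)
  then show ?thesis by (simp add: H1_norm_sq_def L2_norm_sq_def)
qed

text \<open>Since \<open>y < 1\<close>, the moving point stays away from the interface. A box of
  positions and times around it lies inside the moving domain; there \<open>T\<close> is jointly
  differentiable at the point, and the chain rule applies.\<close>

lemma has_real_derivative_along_moving_point:
  fixes T Tt :: "real \<Rightarrow> real \<Rightarrow> real"
  assumes s: "continuous_on {0..} s" "(s has_real_derivative s') (at t)"
    and t: "t > 0" and y: "0 \<le> y" "y < 1" and spos: "s t > 0"
    and Tx: "((\<lambda>x. T x t) has_real_derivative Tx) (at (y * s t) within {0..s t})"
    and Tt: "\<And>t x. t > 0 \<Longrightarrow> x \<in> {0..s t} \<Longrightarrow>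
      ((\<lambda>\<tau>. T x \<tau>) has_real_derivative Tt x t) (at t within {\<tau>. 0 \<le> \<tau> \<and> x \<le> s \<tau>})"
    and Tt_cont: "continuous_on {(x, t). 0 < t \<and> 0 \<le> x \<and> x \<le> s t} (\<lambda>(x, t). Tt x t)"
  shows "((\<lambda>\<tau>. T (y * s \<tau>) \<tau>) has_real_derivative Tt (y * s t) t + y * s' * Tx) (at t)"
proof -
  define x where "x = y * s t"
  \<comment> \<open>The midpoint leaves room on both sides: for times near \<open>t\<close> it stays
    to the right of \<open>y * s \<tau>\<close> and to the left of the interface.\<close>
  define x1 where "x1 = (x + s t) / 2"
  have "y * s t < 1 * s t" using y spos by (intro mult_strict_right_mono) auto
  then have x: "0 \<le> x" "x < x1" "x1 < s t"
    using y spos by (auto simp: x_def x1_def)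
  have "isCont s t" using s(2) DERIV_isCont by blast
  then have sl: "(s \<longlongrightarrow> s t) (at t)" by (simp add: isCont_def)
  have "\<forall>\<^sub>F \<tau> in at t. x1 < s \<tau> \<and> y * s \<tau> < x1 \<and> 0 < \<tau> \<and> 0 < s \<tau>"
    using order_tendstoD(1)[OF sl x(3)] order_tendstoD(1)[OF sl spos]
      order_tendstoD(2)[OF tendsto_mult[OF tendsto_const[of y] sl], folded x_def, OF x(2)]
      order_tendstoD(1)[OF tendsto_ident_at t]
    by eventually_elim auto
  then obtain r where r: "r > 0"
    and rr: "\<And>\<tau>. \<tau> \<noteq> t \<Longrightarrow> dist \<tau> t < r \<Longrightarrow> x1 < s \<tau> \<and> y * s \<tau> < x1 \<and> 0 < \<tau> \<and> 0 < s \<tau>"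
    unfolding eventually_at by blast
  define Y where "Y = ball t r"
  define X where "X = {0..x1}"
  have Y: "x1 < s \<tau>" "y * s \<tau> \<in> X" "0 < \<tau>" if "\<tau> \<in> Y" for \<tau>
    using rr[of \<tau>] that x t spos y unfolding Y_def X_def x_def
    by (cases "\<tau> = t"; force simp: dist_commute)+
  have tY: "t \<in> Y" using r by (simp add: Y_def)
  have "((\<lambda>(x, t). T x t) has_derivative (\<lambda>(u, v). Tx * u + Tt x t * v)) (at (x, t) within X \<times> Y)"
  proof (rule has_derivative_real_partials)
    show "((\<lambda>x. T x t) has_real_derivative Tx) (at x within X)"
      unfolding x_def by (rule DERIV_subset[OF Tx]) (use x in \<open>auto simp: X_def\<close>)
    show "((\<lambda>t. T x t) has_real_derivative Tt x t) (at t within Y)" if "x \<in> X" "t \<in> Y" for x t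
    proof (rule DERIV_subset[OF Tt])
      show "0 < t" "x \<in> {0..s t}" using Y[OF that(2)] that(1) by (auto simp: X_def)
      show "Y \<subseteq> {\<tau>. 0 \<le> \<tau> \<and> x \<le> s \<tau>}"
      proof
        fix \<tau> assume "\<tau> \<in> Y"
        from Y[OF this] that(1) show "\<tau> \<in> {\<tau>. 0 \<le> \<tau> \<and> x \<le> s \<tau>}" by (auto simp: X_def)
      qed
    qed
    have "X \<times> Y \<subseteq> {(x, t). 0 < t \<and> 0 \<le> x \<and> x \<le> s t}"
    proof
      fix z assume "z \<in> X \<times> Y"
      then show "z \<in> {(x, t). 0 < t \<and> 0 \<le> x \<and> x \<le> s t}"
        using Y[of "snd z"] by (auto simp: X_def)
    qed
    from continuous_on_subset[OF Tt_cont this]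
    show "continuous (at (x, t) within X \<times> Y) (\<lambda>(x, t). Tt x t)"
      using tY x by (auto simp: continuous_on_eq_continuous_within X_def)
  qed (use tY in \<open>auto simp: Y_def\<close>)
  moreover have "(\<lambda>\<tau>. (y * s \<tau>, \<tau>)) ` Y \<subseteq> X \<times> Y" using Y(2) by auto
  ultimately have T: "((\<lambda>(x, t). T x t) has_derivative (\<lambda>(u, v). Tx * u + Tt x t * v))
      (at (y * s t, t) within (\<lambda>\<tau>. (y * s \<tau>, \<tau>)) ` Y)"
    unfolding x_def by (rule has_derivative_subset)
  have "((\<lambda>\<tau>. y * s \<tau>) has_real_derivative y * s') (at t within Y)"
    by (rule has_field_derivative_at_within[OF DERIV_cmult[OF s(2)]])
  then have "((\<lambda>\<tau>. (y * s \<tau>, \<tau>)) has_derivative (\<lambda>h. (y * s' * h, h))) (at t within Y)"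
    unfolding has_field_derivative_def by (intro has_derivative_Pair has_derivative_ident)
  from has_derivative_in_compose[OF this T]
  have "((\<lambda>\<tau>. T (y * s \<tau>) \<tau>) has_derivative (\<lambda>h. Tx * (y * s' * h) + Tt x t * h)) (at t within Y)"
    by simp
  moreover have "(\<lambda>h. Tx * (y * s' * h) + Tt x t * h) = (*) (Tt x t + y * s' * Tx)"
    by (rule ext) (simp add: algebra_simps)
  moreover have "at t within Y = at t" using tY at_within_open[of t Y] by (simp add: Y_def)
  ultimately show ?thesis by (simp add: has_field_derivative_def x_def)
qed

text \<open>The pullback along \<open>x = y * s t\<close> turns the heat equation and the Stefan
  condition into the prescribed \<open>w\<close> and \<open>s'\<close>. The norm identity is claimed
  for positive times, where \<open>Tx\<close> is continuous up to the boundary.\<close>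

lemma closed_loop_solution_straightened:
  assumes par: "\<alpha> > 0" "\<beta> > 0" "k > 0" "c > 0" "\<epsilon>\<^sub>1 > -1" "\<epsilon>\<^sub>2 > -1" "\<epsilon>\<^sub>2 \<le> \<epsilon>\<^sub>1"
    and init: "\<And>x. x \<in> {0..s0} \<Longrightarrow> 0 \<le> T0 x - Tm \<and> T0 x - Tm \<le> H * (s0 - x)"
    and setpoint: "sr > s0 + \<beta> / \<alpha> * integral {0..s0} (\<lambda>x. T0 x - Tm)"
    and sol: "closed_loop_solution \<alpha> \<beta> k c \<epsilon>\<^sub>1 \<epsilon>\<^sub>2 Tm sr T0 s0 T s"
  obtains v vy vyy where "straightened_loop \<alpha> \<beta> c \<epsilon>\<^sub>1 \<epsilon>\<^sub>2 sr s v vy vyy"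
    and "\<And>t. t > 0 \<Longrightarrow> stability_norm Tm sr T s t = straightened_loop.\<Phi> sr s v vy t"
proof -
  note sol' = sol[unfolded closed_loop_solution_def]
  have s_cont: "continuous_on {0..} s" and s_pos: "\<And>t. t \<ge> 0 \<Longrightarrow> 0 < s t"
    and T_cont: "continuous_on {(x, t). 0 \<le> t \<and> 0 \<le> x \<and> x \<le> s t} (\<lambda>(x, t). T x t)"
    and s0: "s 0 = s0" and T0: "\<And>x. x \<in> {0..s0} \<Longrightarrow> T x 0 = T0 x"
    using sol' by auto
  from sol' obtain Tx Txx Tt where
    cont: "\<forall>F\<in>{Tx, Txx, Tt}. continuous_on {(x, t). 0 < t \<and> 0 \<le> x \<and> x \<le> s t} (\<lambda>(x, t). F x t)"
    and pde: "\<forall>t>0. \<forall>x\<in>{0..s t}.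
           ((\<lambda>y. T y t) has_real_derivative Tx x t) (at x within {0..s t}) \<and>
           ((\<lambda>y. Tx y t) has_real_derivative Txx x t) (at x within {0..s t}) \<and>
           ((\<lambda>\<tau>. T x \<tau>) has_real_derivative Tt x t) (at t within {\<tau>. 0 \<le> \<tau> \<and> x \<le> s \<tau>}) \<and>
           Tt x t = \<alpha> * (1 + \<epsilon>\<^sub>1) * Txx x t"
    and bc: "\<forall>t>0. - k * Tx 0 t = flux_law \<alpha> \<beta> k c Tm sr (\<lambda>x. T x t) (s t) \<and>
           T (s t) t = Tm \<and>
           (s has_real_derivative - \<beta> * (1 + \<epsilon>\<^sub>2) * Tx (s t) t) (at t)"
    by (elim conjE exE) blast
  have Tx: "((\<lambda>y. T y t) has_real_derivative Tx x t) (at x within {0..s t})"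
    and Txx: "((\<lambda>y. Tx y t) has_real_derivative Txx x t) (at x within {0..s t})"
    and Tt: "((\<lambda>\<tau>. T x \<tau>) has_real_derivative Tt x t) (at t within {\<tau>. 0 \<le> \<tau> \<and> x \<le> s \<tau>})"
    and heat: "Tt x t = \<alpha> * (1 + \<epsilon>\<^sub>1) * Txx x t" if "t > 0" "x \<in> {0..s t}" for x t
    using pde that by blast+
  define v where "v = (\<lambda>y t. T (y * s t) t - Tm)"
  define vy where "vy = (\<lambda>y t. s t * Tx (y * s t) t)"
  define vyy where "vyy = (\<lambda>y t. (s t)\<^sup>2 * Txx (y * s t) t)"
  interpret straightened_data \<alpha> \<beta> c \<epsilon>\<^sub>1 \<epsilon>\<^sub>2 sr s v vy vyy .
  have range: "y * s t \<in> {0..s t}" if "t \<ge> 0" "y \<in> {0..1}" for y t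
    using that s_pos[of t] by (auto intro: mult_left_le_one_le)
  have scale_cont: "continuous_on ({0..1} \<times> I) (\<lambda>(y, t). F (y * s t) t)"
    if F: "continuous_on {(x, t). t \<in> I \<and> 0 \<le> x \<and> x \<le> s t} (\<lambda>(x, t). F x t)" and I: "I \<subseteq> {0..}"
    for F :: "real \<Rightarrow> real \<Rightarrow> real" and I
  proof -
    have "continuous_on ({0..1} \<times> I) (\<lambda>z. (\<lambda>(x, t). F x t) (fst z * s (snd z), snd z))"
    proof (rule continuous_on_compose2[OF F])
      have "continuous_on ({0..1::real} \<times> I) (\<lambda>z. s (snd z))"
        by (rule continuous_on_compose2[OF s_cont continuous_on_snd[OF continuous_on_id]]) (use I in auto)
      then show "continuous_on ({0..1} \<times> I) (\<lambda>z. (fst z * s (snd z), snd z))"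
        by (intro continuous_intros)
      show "(\<lambda>z. (fst z * s (snd z), snd z)) ` ({0..1} \<times> I) \<subseteq> {(x, t). t \<in> I \<and> 0 \<le> x \<and> x \<le> s t}"
      proof clarsimp
        fix y \<tau> :: real assume y: "0 \<le> y" "y \<le> 1" "\<tau> \<in> I"
        then have "\<tau> \<ge> 0" using I by auto
        then show "0 \<le> y * s \<tau> \<and> y * s \<tau> \<le> s \<tau>" using range[of \<tau> y] y by simp
      qed
    qed
    then show ?thesis by (simp add: case_prod_unfold)
  qed
  have s_snd: "continuous_on ({0..1::real} \<times> {0<..}) (\<lambda>z. s (snd z))"
    by (rule continuous_on_compose2[OF s_cont continuous_on_snd[OF continuous_on_id]]) auto
  have scale_deriv: "((\<lambda>y. F (y * s t)) has_real_derivative s t * F') (at y within {0..1})"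
    if "(F has_real_derivative F') (at (y * s t) within {0..s t})" and t: "t > 0"
    for F :: "real \<Rightarrow> real" and F' y t
  proof -
    have "(F has_real_derivative F') (at (y * s t) within (\<lambda>y. y * s t) ` {0..1})"
      by (rule DERIV_subset[OF that(1)]) (use range t in force)
    moreover have "((\<lambda>y. y * s t) has_real_derivative s t) (at y within {0..1})"
      using DERIV_cmult_right[OF DERIV_ident, of "s t"] by simp
    ultimately have "(F \<circ> (\<lambda>y. y * s t) has_real_derivative F' * s t) (at y within {0..1})"
      by (rule DERIV_image_chain)
    then show ?thesis by (simp add: o_def mult.commute)
  qed
  have int: "integral {0..s t} (\<lambda>x. T x t - Tm) = m t" if t: "t \<ge> 0" for t
  proof -
    have "continuous_on {0..s t} (\<lambda>x. (\<lambda>(x, t). T x t) (x, t))"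
      by (rule continuous_on_compose2[OF T_cont]) (use t in \<open>auto intro!: continuous_intros\<close>)
    then have "(\<lambda>x. T x t - Tm) integrable_on {0..s t}"
      by (intro integrable_continuous_interval continuous_intros) simp
    from integral_rescale[OF s_pos[OF t] this] show ?thesis unfolding m_def by (simp add: v_def)
  qed
  have s': "s' t = - \<beta> * (1 + \<epsilon>\<^sub>2) * Tx (s t) t" if "t > 0" for t
    unfolding s'_def p_def using s_pos[of t] that by (simp add: vy_def)
  have w: "w y t = Tt (y * s t) t + y * s' t * Tx (y * s t) t" if "t > 0" "y \<in> {0..1}" for y t
    unfolding w_def using s_pos[of t] that heat[of t "y * s t"] range[of t y] by (simp add: vy_def vyy_def)
  have loop: "straightened_loop \<alpha> \<beta> c \<epsilon>\<^sub>1 \<epsilon>\<^sub>2 sr s v vy vyy"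
  proof (unfold_locales)
    have sub: "{0<..} \<subseteq> {0::real..}" by auto
    show "continuous_on ({0..1} \<times> {0..}) (\<lambda>(y, t). v y t)"
      unfolding v_def using scale_cont[of "{0..}" T] T_cont
      by (auto simp: case_prod_unfold intro!: continuous_intros)
    have "continuous_on ({0..1} \<times> {0<..}) (\<lambda>z. s (snd z) * Tx (fst z * s (snd z)) (snd z))"
      using scale_cont[OF _ sub, of Tx] cont
      by (intro continuous_intros s_snd) (simp add: case_prod_unfold)
    then show "continuous_on ({0..1} \<times> {0<..}) (\<lambda>(y, t). vy y t)"
      by (simp add: vy_def case_prod_unfold)
    have "continuous_on ({0..1} \<times> {0<..}) (\<lambda>z. (s (snd z))\<^sup>2 * Txx (fst z * s (snd z)) (snd z))"
      using scale_cont[OF _ sub, of Txx] cont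
      by (intro continuous_intros s_snd) (simp add: case_prod_unfold)
    then show "continuous_on ({0..1} \<times> {0<..}) (\<lambda>(y, t). vyy y t)"
      by (simp add: vyy_def case_prod_unfold)
    show "0 < e 0"
    proof -
      have "m 0 = integral {0..s0} (\<lambda>x. T0 x - Tm)"
        unfolding int[of 0, simplified, symmetric] s0 by (rule integral_cong) (simp add: T0)
      \<comment> \<open>The setpoint condition is positivity of the initial control error,
        multiplied by \<open>\<beta>\<close>.\<close>
      then have "s0 - sr + \<beta> / \<alpha> * m 0 < 0" using setpoint by simp
      then have "(s0 - sr + \<beta> / \<alpha> * m 0) / \<beta> < 0" using par by (simp add: divide_neg_pos)
      moreover have "(s0 - sr + \<beta> / \<alpha> * m 0) / \<beta> = - e 0"
        using par by (simp add: e_def s0 field_simps)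
      ultimately show ?thesis by simp
    qed
    fix t :: real
    \<comment> \<open>At \<open>t = 0\<close> the interface value comes from the bounds on
      \<open>T0\<close>, which force \<open>T0 s0 = Tm\<close>; at later times it is the boundary
      condition.\<close>
    show "v 1 t = 0" if "t \<ge> 0"
      using bc that init[of s0] T0[of s0] s0 s_pos[of 0] by (cases "t = 0") (auto simp: v_def)
    show "0 \<le> v y 0" if "y \<in> {0..1}" for y
      using init[of "y * s0"] T0[of "y * s0"] range[of 0 y] that s0 by (simp add: v_def)
    assume t: "t > 0"
    show "(s has_real_derivative s' t) (at t)" using bc t s'[OF t] by simp
    show "vy 0 t = - s t * c * e t"
    proof -
      have "- k * Tx 0 t = - c * k * (1 / \<alpha> * m t + 1 / \<beta> * (s t - sr))"
        using bc t unfolding flux_law_def int[OF less_imp_le[OF t], symmetric] by blast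
      then have "Tx 0 t = c * (m t / \<alpha> + (s t - sr) / \<beta>)" using par by simp
      moreover have "m t / \<alpha> + (s t - sr) / \<beta> = - e t" by (simp add: e_def)
      ultimately show ?thesis by (simp add: vy_def)
    qed
    show "(v y has_real_derivative w y t) (at t)" if y: "0 \<le> y" "y < 1" for y
    proof -
      have "((\<lambda>\<tau>. T (y * s \<tau>) \<tau>) has_real_derivative Tt (y * s t) t + y * s' t * Tx (y * s t) t) (at t)"
      proof (rule has_real_derivative_along_moving_point[OF s_cont _ t y])
        show "((\<lambda>x. T x t) has_real_derivative Tx (y * s t) t) (at (y * s t) within {0..s t})"
          using t y range[of t y] by (intro Tx) auto
        show "(s has_real_derivative s' t) (at t)" using bc t s'[OF t] by simp
        show "((\<lambda>\<tau>. T x \<tau>) has_real_derivative Tt x t) (at t within {\<tau>. 0 \<le> \<tau> \<and> x \<le> s \<tau>})"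
          if "t > 0" "x \<in> {0..s t}" for t x using that by (rule Tt)
      qed (use cont t s_pos in auto)
      then show ?thesis
        using w[OF t, of y] y by (auto simp: v_def intro!: derivative_eq_intros)
    qed
    fix y :: real assume y: "y \<in> {0..1}"
    have "((\<lambda>y. T (y * s t) t) has_real_derivative s t * Tx (y * s t) t) (at y within {0..1})"
      by (rule scale_deriv[OF _ t, of "\<lambda>x. T x t"]) (use t y range[of t y] in \<open>auto intro: Tx\<close>)
    then show "((\<lambda>y. v y t) has_real_derivative vy y t) (at y within {0..1})"
      by (auto simp: v_def vy_def intro!: derivative_eq_intros)
    have "((\<lambda>y. Tx (y * s t) t) has_real_derivative s t * Txx (y * s t) t) (at y within {0..1})"
      by (rule scale_deriv[OF _ t, of "\<lambda>x. Tx x t"]) (use t y range[of t y] in \<open>auto intro: Txx\<close>)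
    from DERIV_cmult[OF this, of "s t"]
    show "((\<lambda>y. vy y t) has_real_derivative vyy y t) (at y within {0..1})"
      by (simp add: vy_def vyy_def power2_eq_square mult.assoc)
  qed (use par s_cont s_pos in auto)
  moreover have "stability_norm Tm sr T s t = straightened_loop.\<Phi> sr s v vy t" if t: "t > 0" for t
  proof -
    interpret straightened_loop \<alpha> \<beta> c \<epsilon>\<^sub>1 \<epsilon>\<^sub>2 sr s v vy vyy by (rule loop)
    have "continuous_on {0..s t} (\<lambda>x. (\<lambda>(x, t). Tx x t) (x, t))"
      by (rule continuous_on_compose2[of "{(x, t). 0 < t \<and> 0 \<le> x \<and> x \<le> s t}"])
        (use cont t in \<open>auto intro!: continuous_intros\<close>)
    then have "H1_norm_sq (s t) (\<lambda>x. T x t - Tm) =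
        s t * integral {0..1} (\<lambda>y. (T (y * s t) t - Tm)\<^sup>2) + integral {0..1} (\<lambda>y. (s t * Tx (y * s t) t)\<^sup>2) / s t"
      using t s_pos[of t]
      by (intro H1_norm_sq_eq) (auto intro!: derivative_eq_intros Tx)
    then show ?thesis
      unfolding stability_norm_def \<Phi>_def R_def N_def by (simp add: v_def vy_def)
  qed
  ultimately show thesis using that by blast
qed

section \<open>Uniform constants and the limit at the initial time\<close>

theorem theorem2:
  fixes \<alpha> \<beta> k c Tm sr \<epsilon>\<^sub>1 \<epsilon>\<^sub>2 :: real
  assumes "\<alpha> > 0" and "\<beta> > 0" and "k > 0" and "c > 0"
    and "\<epsilon>\<^sub>1 > -1" and "\<epsilon>\<^sub>2 > -1"
    and "(\<epsilon>\<^sub>1, \<epsilon>\<^sub>2) \<in> perturbation_region \<alpha> sr c"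
  shows "\<exists>D>0. \<exists>b>0. \<forall>(s0::real) (T0::real \<Rightarrow> real) (T::real \<Rightarrow> real \<Rightarrow> real) (s::real \<Rightarrow> real).
           s0 > 0 \<longrightarrow>
           (\<exists>H. \<forall>x\<in>{0..s0}. 0 \<le> T0 x - Tm \<and> T0 x - Tm \<le> H * (s0 - x)) \<longrightarrow>
           sr > s0 + \<beta> / \<alpha> * integral {0..s0} (\<lambda>x. T0 x - Tm) \<longrightarrow>
           closed_loop_solution \<alpha> \<beta> k c \<epsilon>\<^sub>1 \<epsilon>\<^sub>2 Tm sr T0 s0 T s \<longrightarrow>
           (\<forall>t\<ge>0. stability_norm Tm sr T s t \<le> D * stability_norm Tm sr T s 0 * exp (- b * t))"
proof -
  have le: "\<epsilon>\<^sub>2 \<le> \<epsilon>\<^sub>1" using assms(7) by (simp add: perturbation_region_def)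
  have "\<exists>D>0. \<exists>b>0. \<forall>s v vy vyy. straightened_loop \<alpha> \<beta> c \<epsilon>\<^sub>1 \<epsilon>\<^sub>2 sr s v vy vyy \<longrightarrow>
    (\<forall>t0 t. 0 < t0 \<and> t0 \<le> t \<longrightarrow>
      straightened_loop.\<Phi> sr s v vy t \<le> D * straightened_loop.\<Phi> sr s v vy t0 * exp (- b * (t - t0)))"
  proof (cases "sr > 0")
    case True
    then show ?thesis by (intro straightened_loop_decay assms le)
  next
    case False
    \<comment> \<open>For \<open>sr \<le> 0\<close> no such system exists because
      \<open>0 < s 0 < sr\<close>, so arbitrary positive constants serve.\<close>
    then have "\<not> straightened_loop \<alpha> \<beta> c \<epsilon>\<^sub>1 \<epsilon>\<^sub>2 sr s v vy vyy" for s v vy vyy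
      using straightened_loop.setpoint_pos by blast
    then show ?thesis by (auto intro!: exI[of _ "1::real"])
  qed
  then obtain D b where D: "D > 0" "b > 0" and decay:
    "\<And>s v vy vyy t0 t. straightened_loop \<alpha> \<beta> c \<epsilon>\<^sub>1 \<epsilon>\<^sub>2 sr s v vy vyy \<Longrightarrow> 0 < t0 \<Longrightarrow> t0 \<le> t \<Longrightarrow>
      straightened_loop.\<Phi> sr s v vy t \<le> D * straightened_loop.\<Phi> sr s v vy t0 * exp (- b * (t - t0))"
    by blast
  \<comment> \<open>The factor \<open>D + 1\<close> is at least 1, so the estimate also covers
    \<open>t = 0\<close>.\<close>
  have "stability_norm Tm sr T s t \<le> (D + 1) * stability_norm Tm sr T s 0 * exp (- b * t)"
    if H: "\<forall>x\<in>{0..s0}. 0 \<le> T0 x - Tm \<and> T0 x - Tm \<le> H * (s0 - x)"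
      and setpoint: "sr > s0 + \<beta> / \<alpha> * integral {0..s0} (\<lambda>x. T0 x - Tm)"
      and sol: "closed_loop_solution \<alpha> \<beta> k c \<epsilon>\<^sub>1 \<epsilon>\<^sub>2 Tm sr T0 s0 T s" and t: "t \<ge> 0"
    for s0 T0 T s H t
  proof -
    let ?\<Phi> = "stability_norm Tm sr T s"
    obtain v vy vyy where loop: "straightened_loop \<alpha> \<beta> c \<epsilon>\<^sub>1 \<epsilon>\<^sub>2 sr s v vy vyy"
      and \<Phi>: "\<And>t. t > 0 \<Longrightarrow> ?\<Phi> t = straightened_loop.\<Phi> sr s v vy t"
      by (rule closed_loop_solution_straightened[OF assms(1-6) le _ setpoint sol]) (use H in auto)
    have nonneg: "?\<Phi> 0 \<ge> 0" by (simp add: stability_norm_def H1_norm_sq_nonneg)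
    \<comment> \<open>Decay is available from every starting time \<open>t0 > 0\<close>. Letting
      \<open>t0\<close> tend to 0 uses that the initial datum is attained in the \<open>H1\<close>
      norm and that \<open>s\<close> is continuous.\<close>
    have "?\<Phi> t \<le> D * ?\<Phi> 0 * exp (- b * t)" if "t > 0"
    proof (rule tendsto_lowerbound)
      have "((\<lambda>t. H1_norm_sq (s t) (\<lambda>x. T x t - Tm)) \<longlongrightarrow> H1_norm_sq (s 0) (\<lambda>x. T x 0 - Tm)) (at_right 0)"
        and "continuous_on {0..} s"
        using sol by (auto simp: closed_loop_solution_def)
      moreover from this(2) have "(s \<longlongrightarrow> s 0) (at_right 0)"
        by (auto simp: continuous_on_def intro: tendsto_within_subset)
      ultimately have "(?\<Phi> \<longlongrightarrow> ?\<Phi> 0) (at_right 0)"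
        unfolding stability_norm_def by (intro tendsto_intros)
      then have "((\<lambda>t0. D * ?\<Phi> t0 * exp (- b * (t - t0))) \<longlongrightarrow> D * ?\<Phi> 0 * exp (- b * (t - 0))) (at_right 0)"
        by (intro tendsto_intros)
      then show "((\<lambda>t0. D * ?\<Phi> t0 * exp (- b * (t - t0))) \<longlongrightarrow> D * ?\<Phi> 0 * exp (- b * t)) (at_right 0)"
        by simp
      show "\<forall>\<^sub>F t0 in at_right 0. ?\<Phi> t \<le> D * ?\<Phi> t0 * exp (- b * (t - t0))"
        using eventually_at_right_real[OF that]
        by eventually_elim (use decay[OF loop] \<Phi> that in auto)
    qed simp
    moreover have "D * ?\<Phi> 0 * exp (- b * t) \<le> (D + 1) * ?\<Phi> 0 * exp (- b * t)"
      using nonneg by (intro mult_right_mono) auto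
    moreover have "?\<Phi> 0 \<le> (D + 1) * ?\<Phi> 0 * exp (- b * 0)"
      using nonneg D by (simp add: algebra_simps)
    ultimately show ?thesis using t by (cases "t = 0") auto
  qed
  moreover have "D + 1 > 0" using D by simp
  ultimately show ?thesis using D(2) by blast
qed

end
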